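(* Let $T$ be a semi-infinite banded stochastic matrix ($p$ subdiagonals, $q$ superdiagonals) admitting a positive bidiagonal factorization (equivalently, a stochastic bidiagonal factorization), and let $(\mathrm d\psi_{b,a})$ be the associated matrix of positive spectral measures on $[0,1]$. The Markov chain on $\mathbb N_0$ with transition matrix $T$ is recurrent if and only if the integral $$\int_0^{1}\frac{\mathrm d\psi_{1,1}(x)}{1-x}$$ diverges. Otherwise it is transient.
   Context: A state $i$ is recurrent if $\lim_{s\to1^-}F_{i,i}(s)=1$, where $F_{i,i}(s)=\sum_{r\ge1}f^r_{i,i}s^r$ and $f^r_{i,i}=\Pr(X_r=i,X_{r-1}\ne i,\dots,X_1\ne i\mid X_0=i)$; otherwise it is transient. The chain is recurrent if all states are recurrent, and transient otherwise. Semi-infinite matrices are indexed by $\mathbb N_0$. $p,q\ge1$ are integers. $T$ is stochastic (nonnegative entries, rows sum to $1$) and banded: $T_{n,m}=0$ unless $n-p\le m\le n+q$, with positive entries inside the band. A positive bidiagonal factorization is $T=\mathscr L_1\cdots\mathscr L_p\mathscr U_q\cdots\mathscr U_1$ with each $\mathscr L_i$ lower bidiagonal with positive main diagonal and first subdiagonal, and each $\mathscr U_j$ upper bidiagonal with positive main diagonal and first superdiagonal (all other entries zero); it is a stochastic bidiagonal factorization if moreover all factors are stochastic. $T^{[N]}=(T_{n,m})_{n,m=0}^N$; its eigenvalues $\lambda_0^{[N]}>\dots>\lambda_N^{[N]}$ are simple and lie in $(0,1)$ (known). Recursion polynomials. Let $\nu\in\mathbb R^{p\times p}$ and $\xi\in\mathbb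 R^{q\times q}$ be real unitriangular lower matrices (ones on the diagonal, zeros above; the initial conditions). For $a\in\{1,\dots,p\}$, the polynomials $A^{(a)}_n(x)$, $n\ge0$, are determined by $A^{(a)}_n=\nu_{n+1,a}$ for $0\le n\le p-1$ and $\sum_{l\ge0}A^{(a)}_l T_{l,n}=xA^{(a)}_n$, $n\ge0$. For $b\in\{1,\dots,q\}$, $B^{(b)}_n(x)$ are determined by $B^{(b)}_n=\xi_{n+1,b}$ for $0\le n\le q-1$ and $\sum_{l\ge0}T_{n,l}B^{(b)}_l=xB^{(b)}_n$, $n\ge0$. Let $P_0=1$, $P_{M}(x)=\det(xI_{M}-T^{[M-1]})$ for $M\ge1$; $\alpha_0=\beta_0=1$, $\alpha_N=(-1)^{(p-1)N}T_{p,0}\cdots T_{N+p-1,N-1}$, $\beta_N=(-1)^{(q-1)N}T_{0,q}\cdots T_{N-1,N+q-1}$ for $N\ge1$. For $n\ge0$, $Q_{n,N}$ is the $p\times p$ determinant with rows $(A^{(1)}_l,\dots,A^{(p)}_l)$, $l=n,N+1,\dots,N+p-1$ (in this order), and $R_{n,N}$ is the $q\times q$ determinant with rows $(B^{(1)}_l,\dots,B^{(q)}_l)$, $l=n,N+1,\dots,N+q-1$. Put $u^{\langle N\rangle}_{k,n}=\beta_N R_{n,N}(\lambda_k^{[N]})$, $w^{\langle N\rangle}_{k,n}=\dfrac{\alpha_N Q_{n,N}(\lambda_k^{[N]})}{P_N(\lambda_k^{[N]})P_{N+1}'(\lambda_k^{[N]})}$ ($n\ge0$, $0\le k\le N$):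 for $0\le n\le N$ these are the entries of right, resp. left, eigenvectors of $T^{[N]}$ for $\lambda_k^{[N]}$, biorthonormal: $\sum_{n=0}^N w^{\langle N\rangle}_{k,n}u^{\langle N\rangle}_{l,n}=\delta_{k,l}$ (known). The Christoffel numbers are $(\mu_{k,1}^{[N]},\dots,\mu_{k,p}^{[N]})^\top=\nu^{-1}(w_{k,0}^{\langle N\rangle},\dots,w_{k,p-1}^{\langle N\rangle})^\top$, $(\rho_{k,1}^{[N]},\dots,\rho_{k,q}^{[N]})^\top=\xi^{-1}(u_{k,0}^{\langle N\rangle},\dots,u_{k,q-1}^{\langle N\rangle})^\top$. The discrete measures are $\mathrm d\psi^{[N]}_{b,a}=\sum_{k=0}^N\rho^{[N]}_{k,b}\mu^{[N]}_{k,a}\,\delta_{\lambda_k^{[N]}}$. Standing choice of initial conditions: $\nu,\xi$ are chosen so that all Christoffel numbers $\rho^{[N]}_{k,b}$, $\mu^{[N]}_{k,a}$ ($0\le k\le N$) are positive for all sufficiently large $N$; when $T$ has a positive bidiagonal factorization such a choice exists (known). The total masses of $\mathrm d\psi^{[N]}_{b,a}$ are then uniformly bounded in $N$, and $\mathrm d\psi_{b,a}$ denotes the weak limit, as $N\to\infty$ (along a subsequence), of $\mathrm d\psi^{[N]}_{b,a}$: a finite positive Borel measure on $[0,1]$. Known spectral (Favard-type) theorem: $(T^k)_{n,m}=\sum_{a=1}^p\sum_{b=1}^q\int_0^1B_n^{(b)}(x)x^k\,\mathrm d\psi_{b,a}(x)A_m^{(a)}(x)$ for all $k,n,m\in\mathbb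 N_0$. *)

theory Defs
  imports
    "HOL-Probability.Probability"
    "Jordan_Normal_Form.Gauss_Jordan_Elimination"
    "Jordan_Normal_Form.Spectral_Radius"
begin

text \<open>
  Semi-infinite matrices are functions of two natural numbers (row, column); finite matrices and
  vectors are those of Jordan_Normal_Form.  The superscripts \<open>a \<in> {1..p}\<close> and \<open>b \<in> {1..q}\<close> of the
  source are shifted to \<open>a < p\<close> and \<open>b < q\<close>, so the measure \<open>\<psi>\<^sub>1\<^sub>,\<^sub>1\<close> appears as \<open>\<psi> 0 0\<close>.
\<close>

type_synonym smat = "nat \<Rightarrow> nat \<Rightarrow> real"

section \<open>Transition matrices and bidiagonal factorizations\<close>

definition stochastic :: "smat \<Rightarrow> bool" where
  "stochastic T \<longleftrightarrow> (\<forall>n m. 0 \<le> T n m) \<and> (\<forall>n. T n sums 1)"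

definition positive_band :: "nat \<Rightarrow> nat \<Rightarrow> smat \<Rightarrow> bool" where
  "positive_band p q T \<longleftrightarrow>
     (\<forall>n m. if n \<le> m + p \<and> m \<le> n + q then 0 < T n m else T n m = 0)"

definition pos_lower_bidiagonal :: "smat \<Rightarrow> bool" where
  "pos_lower_bidiagonal L \<longleftrightarrow>
     (\<forall>n m. if n = m \<or> n = Suc m then 0 < L n m else L n m = 0)"

definition pos_upper_bidiagonal :: "smat \<Rightarrow> bool" where
  "pos_upper_bidiagonal U \<longleftrightarrow>
     (\<forall>n m. if m = n \<or> m = Suc n then 0 < U n m else U n m = 0)"

definition smat_one :: smat where
  "smat_one n m = (if n = m then 1 else 0)"

text \<open>Only used with row-finite left factors, so that the series is a finite sum.\<close>

definition smat_mult :: "smat \<Rightarrow> smat \<Rightarrow> smat" where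
  "smat_mult A B n m = (\<Sum>k. A n k * B k m)"

text \<open>\<open>Ls = [L\<^sub>1, \<dots>, L\<^sub>p]\<close> and \<open>Us = [U\<^sub>q, \<dots>, U\<^sub>1]\<close>, i.e. the factors in the order of the product.\<close>

definition positive_bidiagonal_factorization :: "nat \<Rightarrow> nat \<Rightarrow> smat \<Rightarrow> bool" where
  "positive_bidiagonal_factorization p q T \<longleftrightarrow>
     (\<exists>Ls Us. length Ls = p \<and> length Us = q \<and>
        (\<forall>L\<in>set Ls. pos_lower_bidiagonal L) \<and> (\<forall>U\<in>set Us. pos_upper_bidiagonal U) \<and>
        T = foldr smat_mult (Ls @ Us) smat_one)"

section \<open>The Markov chain and recurrence\<close>

definition step_pmf :: "smat \<Rightarrow> nat \<Rightarrow> nat pmf" where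
  "step_pmf T i = embed_pmf (T i)"

lemma pmf_step_pmf:
  assumes "stochastic T"
  shows "pmf (step_pmf T i) j = T i j"
  unfolding step_pmf_def
proof (rule pmf_embed_pmf)
  show "0 \<le> T i j" for j
    using assms by (simp add: stochastic_def)
  have "(\<integral>\<^sup>+ j. ennreal (T i j) \<partial>count_space UNIV) = (\<Sum>j. ennreal (T i j))"
    by (rule nn_integral_count_space_nat)
  also have "\<dots> = ennreal (\<Sum>j. T i j)"
    using assms by (intro suminf_ennreal2) (auto simp: stochastic_def sums_iff)
  also have "\<dots> = 1"
    using assms by (simp add: stochastic_def sums_iff)
  finally show "(\<integral>\<^sup>+ j. ennreal (T i j) \<partial>count_space UNIV) = 1" .
qed

text \<open>The joint law of \<open>[X\<^sub>0, \<dots>, X\<^sub>r]\<close> given \<open>X\<^sub>0 = i\<close>.\<close>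

primrec trajectory_pmf :: "smat \<Rightarrow> nat \<Rightarrow> nat \<Rightarrow> nat list pmf" where
  "trajectory_pmf T 0 i = return_pmf [i]"
| "trajectory_pmf T (Suc r) i =
     bind_pmf (step_pmf T i) (\<lambda>j. map_pmf (\<lambda>X. i # X) (trajectory_pmf T r j))"

definition first_return_prob :: "smat \<Rightarrow> nat \<Rightarrow> nat \<Rightarrow> real" where
  "first_return_prob T i r =
     measure_pmf.prob (trajectory_pmf T r i) {X. X ! r = i \<and> (\<forall>t\<in>{1..<r}. X ! t \<noteq> i)}"

definition first_return_gf :: "smat \<Rightarrow> nat \<Rightarrow> real \<Rightarrow> real" where
  "first_return_gf T i s = (\<Sum>r. first_return_prob T i (Suc r) * s ^ Suc r)"

definition recurrent_state :: "smat \<Rightarrow> nat \<Rightarrow> bool" where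
  "recurrent_state T i \<longleftrightarrow> (first_return_gf T i \<longlongrightarrow> 1) (at_left 1)"

definition recurrent_chain :: "smat \<Rightarrow> bool" where
  "recurrent_chain T \<longleftrightarrow> (\<forall>i. recurrent_state T i)"

definition transient_chain :: "smat \<Rightarrow> bool" where
  "transient_chain T \<longleftrightarrow> \<not> recurrent_chain T"

section \<open>Recursion polynomials\<close>

definition lower_unitriangular :: "nat \<Rightarrow> real mat \<Rightarrow> bool" where
  "lower_unitriangular d M \<longleftrightarrow> M \<in> carrier_mat d d \<and>
     (\<forall>i<d. M $$ (i, i) = 1) \<and> (\<forall>i<d. \<forall>j<d. i < j \<longrightarrow> M $$ (i, j) = 0)"

text \<open>
  The upper summation bounds are those of the band: column \<open>n\<close> of \<open>T\<close> vanishes below row \<open>n + p\<close>,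
  row \<open>n\<close> vanishes beyond column \<open>n + q\<close>.
\<close>

definition left_poly :: "nat \<Rightarrow> smat \<Rightarrow> real mat \<Rightarrow> nat \<Rightarrow> nat \<Rightarrow> real poly" where
  "left_poly p T \<nu> a = (THE A.
     (\<forall>n<p. A n = [:\<nu> $$ (n, a):]) \<and>
     (\<forall>n. (\<Sum>l\<le>n + p. Polynomial.smult (T l n) (A l)) = [:0, 1:] * A n))"

definition right_poly :: "nat \<Rightarrow> smat \<Rightarrow> real mat \<Rightarrow> nat \<Rightarrow> nat \<Rightarrow> real poly" where
  "right_poly q T \<xi> b = (THE B.
     (\<forall>n<q. B n = [:\<xi> $$ (n, b):]) \<and>
     (\<forall>n. (\<Sum>l\<le>n + q. Polynomial.smult (T n l) (B l)) = [:0, 1:] * B n))"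

context
  fixes S :: smat and d :: nat and c :: "nat \<Rightarrow> real"
begin

fun rec_poly :: "nat \<Rightarrow> real poly" where
  "rec_poly n = (if n < d \<or> d = 0 then [:c n:]
     else Polynomial.smult (1 / S (n - d) n)
       ([:0, 1:] * rec_poly (n - d) - (\<Sum>l<n. Polynomial.smult (S (n - d) l) (rec_poly l))))"

declare rec_poly.simps [simp del]

lemma ex1_rec_poly:
  assumes "0 < d" and nz: "\<And>n. S n (n + d) \<noteq> 0"
  shows "\<exists>!F. (\<forall>n<d. F n = [:c n:]) \<and>
           (\<forall>n. (\<Sum>l\<le>n + d. Polynomial.smult (S n l) (F l)) = [:0, 1:] * F n)"
proof (rule ex1I[of _ rec_poly], intro conjI allI impI)
  fix n assume "n < d"
  then show "rec_poly n = [:c n:]" by (simp add: rec_poly.simps)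
next
  fix n
  have "rec_poly (n + d) = Polynomial.smult (1 / S n (n + d))
      ([:0, 1:] * rec_poly n - (\<Sum>l<n + d. Polynomial.smult (S n l) (rec_poly l)))"
    using \<open>0 < d\<close> by (subst rec_poly.simps) simp
  then have "Polynomial.smult (S n (n + d)) (rec_poly (n + d)) =
      [:0, 1:] * rec_poly n - (\<Sum>l<n + d. Polynomial.smult (S n l) (rec_poly l))"
    using nz[of n] by simp
  then show "(\<Sum>l\<le>n + d. Polynomial.smult (S n l) (rec_poly l)) = [:0, 1:] * rec_poly n"
    by (simp add: lessThan_Suc_atMost[symmetric])
next
  fix F
  assume F: "(\<forall>n<d. F n = [:c n:]) \<and>
    (\<forall>n. (\<Sum>l\<le>n + d. Polynomial.smult (S n l) (F l)) = [:0, 1:] * F n)"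
  have "F n = rec_poly n" for n
  proof (induction n rule: less_induct)
    case (less n)
    show ?case
    proof (cases "n < d")
      case True
      then show ?thesis using F by (simp add: rec_poly.simps)
    next
      case False
      define m where "m = n - d"
      have n: "n = m + d" using False by (simp add: m_def)
      have "Polynomial.smult (S m n) (F n) + (\<Sum>l<n. Polynomial.smult (S m l) (F l))
          = [:0, 1:] * F m"
        using conjunct2[OF F, rule_format, of m] n
        by (simp add: lessThan_Suc_atMost[symmetric] add.commute)
      then have "Polynomial.smult (S m n) (F n)
          = [:0, 1:] * F m - (\<Sum>l<n. Polynomial.smult (S m l) (F l))"
        by (simp add: algebra_simps)
      then have "F n = Polynomial.smult (1 / S m n)
          ([:0, 1:] * F m - (\<Sum>l<n. Polynomial.smult (S m l) (F l)))"
        using nz[of m] n by (metis smult_smult nonzero_divide_eq_eq smult_1_left)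
      also have "\<dots> = Polynomial.smult (1 / S m n)
          ([:0, 1:] * rec_poly m - (\<Sum>l<n. Polynomial.smult (S m l) (rec_poly l)))"
        using less \<open>0 < d\<close> n by simp
      also have "\<dots> = rec_poly n"
        using False \<open>0 < d\<close> by (subst (3) rec_poly.simps) (simp add: m_def)
      finally show ?thesis .
    qed
  qed
  then show "F = rec_poly" by (rule ext)
qed

end

lemma left_poly:
  assumes "0 < p" "positive_band p q T"
  shows "n < p \<Longrightarrow> left_poly p T \<nu> a n = [:\<nu> $$ (n, a):]"
    and "(\<Sum>l\<le>n + p. Polynomial.smult (T l n) (left_poly p T \<nu> a l)) = [:0, 1:] * left_poly p T \<nu> a n"
proof -
  have "T (n + p) n \<noteq> 0" for n
    using assms(2) unfolding positive_band_def by (metis le_add1 le_refl less_irrefl trans_le_add1)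
  from theI'[OF ex1_rec_poly[of p "\<lambda>n l. T l n" "\<lambda>n. \<nu> $$ (n, a)", OF assms(1) this]]
  show "n < p \<Longrightarrow> left_poly p T \<nu> a n = [:\<nu> $$ (n, a):]"
    and "(\<Sum>l\<le>n + p. Polynomial.smult (T l n) (left_poly p T \<nu> a l)) = [:0, 1:] * left_poly p T \<nu> a n"
    unfolding left_poly_def by auto
qed

lemma right_poly:
  assumes "0 < q" "positive_band p q T"
  shows "n < q \<Longrightarrow> right_poly q T \<xi> b n = [:\<xi> $$ (n, b):]"
    and "(\<Sum>l\<le>n + q. Polynomial.smult (T n l) (right_poly q T \<xi> b l)) = [:0, 1:] * right_poly q T \<xi> b n"
proof -
  have "T n (n + q) \<noteq> 0" for n
    using assms(2) unfolding positive_band_def by (metis le_add1 le_refl less_irrefl trans_le_add1)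
  from theI'[OF ex1_rec_poly[of q T "\<lambda>n. \<xi> $$ (n, b)", OF assms(1) this]]
  show "n < q \<Longrightarrow> right_poly q T \<xi> b n = [:\<xi> $$ (n, b):]"
    and "(\<Sum>l\<le>n + q. Polynomial.smult (T n l) (right_poly q T \<xi> b l)) = [:0, 1:] * right_poly q T \<xi> b n"
    unfolding right_poly_def by auto
qed

section \<open>Truncations, eigenvectors and Christoffel numbers\<close>

text \<open>The leading \<open>M \<times> M\<close> block; the source's \<open>T\<^sup>[\<^sup>N\<^sup>]\<close> is \<open>leading_block T (Suc N)\<close>.\<close>

definition leading_block :: "smat \<Rightarrow> nat \<Rightarrow> real mat" where
  "leading_block T M = Matrix.mat M M (\<lambda>(n, m). T n m)"

definition block_char_poly :: "smat \<Rightarrow> nat \<Rightarrow> real poly" where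
  "block_char_poly T M = char_poly (leading_block T M)"

text \<open>
  The \<open>k\<close>-th eigenvalue, counting from \<open>k = 0\<close> in decreasing order, of the truncation with indices
  \<open>0, \<dots>, N\<close>; for the matrices considered the spectrum has exactly \<open>N + 1\<close> elements.
\<close>

definition ev :: "smat \<Rightarrow> nat \<Rightarrow> nat \<Rightarrow> real" where
  "ev T N k = rev (sorted_list_of_set (spectrum (leading_block T (Suc N)))) ! k"

definition \<alpha>_coeff :: "nat \<Rightarrow> smat \<Rightarrow> nat \<Rightarrow> real" where
  "\<alpha>_coeff p T N = (- 1) ^ ((p - 1) * N) * (\<Prod>i<N. T (i + p) i)"

definition \<beta>_coeff :: "nat \<Rightarrow> smat \<Rightarrow> nat \<Rightarrow> real" where
  "\<beta>_coeff q T N = (- 1) ^ ((q - 1) * N) * (\<Prod>i<N. T i (i + q))"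

definition Q_poly :: "nat \<Rightarrow> smat \<Rightarrow> real mat \<Rightarrow> nat \<Rightarrow> nat \<Rightarrow> real poly" where
  "Q_poly p T \<nu> n N = Determinant.det
     (Matrix.mat p p (\<lambda>(i, a). left_poly p T \<nu> a (if i = 0 then n else N + i)))"

definition R_poly :: "nat \<Rightarrow> smat \<Rightarrow> real mat \<Rightarrow> nat \<Rightarrow> nat \<Rightarrow> real poly" where
  "R_poly q T \<xi> n N = Determinant.det
     (Matrix.mat q q (\<lambda>(i, b). right_poly q T \<xi> b (if i = 0 then n else N + i)))"

definition u_vec :: "nat \<Rightarrow> smat \<Rightarrow> real mat \<Rightarrow> nat \<Rightarrow> nat \<Rightarrow> nat \<Rightarrow> real" where
  "u_vec q T \<xi> N k n = \<beta>_coeff q T N * poly (R_poly q T \<xi> n N) (ev T N k)"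

definition w_vec :: "nat \<Rightarrow> smat \<Rightarrow> real mat \<Rightarrow> nat \<Rightarrow> nat \<Rightarrow> nat \<Rightarrow> real" where
  "w_vec p T \<nu> N k n = \<alpha>_coeff p T N * poly (Q_poly p T \<nu> n N) (ev T N k) /
     (poly (block_char_poly T N) (ev T N k) * poly (pderiv (block_char_poly T (Suc N))) (ev T N k))"

text \<open>The inverses exist because the initial conditions are unitriangular.\<close>

definition christoffel_\<mu> :: "nat \<Rightarrow> smat \<Rightarrow> real mat \<Rightarrow> nat \<Rightarrow> nat \<Rightarrow> nat \<Rightarrow> real" where
  "christoffel_\<mu> p T \<nu> N k a =
     (the (mat_inverse \<nu>) *\<^sub>v Matrix.vec p (w_vec p T \<nu> N k)) $ a"

definition christoffel_\<rho> :: "nat \<Rightarrow> smat \<Rightarrow> real mat \<Rightarrow> nat \<Rightarrow> nat \<Rightarrow> nat \<Rightarrow> real" where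
  "christoffel_\<rho> q T \<xi> N k b =
     (the (mat_inverse \<xi>) *\<^sub>v Matrix.vec q (u_vec q T \<xi> N k)) $ b"

definition eventually_positive_christoffel ::
  "nat \<Rightarrow> nat \<Rightarrow> smat \<Rightarrow> real mat \<Rightarrow> real mat \<Rightarrow> bool" where
  "eventually_positive_christoffel p q T \<nu> \<xi> \<longleftrightarrow>
     (\<forall>\<^sub>F N in sequentially. \<forall>k\<le>N.
        (\<forall>a<p. 0 < christoffel_\<mu> p T \<nu> N k a) \<and> (\<forall>b<q. 0 < christoffel_\<rho> q T \<xi> N k b))"

section \<open>Discrete and spectral measures\<close>

text \<open>
  The sum over \<open>k \<le> N\<close> of point masses \<open>\<rho>\<^sub>k\<^sub>,\<^sub>b \<mu>\<^sub>k\<^sub>,\<^sub>a\<close> at the eigenvalues, as an image measure.  The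
  truncation of negative weights by \<open>ennreal\<close> only concerns those finitely many \<open>N\<close> for which the
  Christoffel numbers need not be positive.
\<close>

definition discrete_measure ::
  "nat \<Rightarrow> nat \<Rightarrow> smat \<Rightarrow> real mat \<Rightarrow> real mat \<Rightarrow> nat \<Rightarrow> nat \<Rightarrow> nat \<Rightarrow> real measure" where
  "discrete_measure p q T \<nu> \<xi> N b a =
     distr (point_measure {..N}
         (\<lambda>k. ennreal (christoffel_\<rho> q T \<xi> N k b * christoffel_\<mu> p T \<nu> N k a)))
       borel (ev T N)"

text \<open>
  Weak convergence is the library's convergence of distribution functions.  No mass can escape: the
  limit is finite and lives on \<open>[0, 1]\<close>, so its distribution function is continuous, and equal to
  the total mass, to the right of 1.
\<close>

definition spectral_measures ::
  "nat \<Rightarrow> nat \<Rightarrow> smat \<Rightarrow> real mat \<Rightarrow> real mat \<Rightarrow> (nat \<Rightarrow> nat \<Rightarrow> real measure) \<Rightarrow> bool" where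
  "spectral_measures p q T \<nu> \<xi> \<psi> \<longleftrightarrow>
     (\<forall>b<q. \<forall>a<p. finite_borel_measure (\<psi> b a) \<and> (AE x in \<psi> b a. x \<in> {0..1})) \<and>
     (\<exists>r :: nat \<Rightarrow> nat. strict_mono r \<and>
        (\<forall>b<q. \<forall>a<p. weak_conv_m (\<lambda>j. discrete_measure p q T \<nu> \<xi> (r j) b a) (\<psi> b a)))"

text \<open>
  Division is that of \<open>ennreal\<close>, where \<open>1 / 0 = \<infinity>\<close>: a point mass at 1 makes the integral diverge
  (with real division it would contribute 0).
\<close>

definition recurrence_integral :: "real measure \<Rightarrow> ennreal" where
  "recurrence_integral M = (\<integral>\<^sup>+ x\<in>{0..1}. 1 / ennreal (1 - x) \<partial>M)"

end

theory Submission
  imports Defs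
begin

text \<open>
  Only the measure \<open>\<psi>\<^sub>1\<^sub>,\<^sub>1\<close> matters: its \<open>k\<close>-th moment is \<open>(T\<^sup>k)\<^sub>0\<^sub>,\<^sub>0\<close>, because the initial conditions are
  unitriangular and therefore the first Christoffel numbers are the first entries of the eigenvectors.
  Summing over \<open>k\<close>, the integral of \<open>1 / (1 - x)\<close> equals the Green function of the chain at \<open>0\<close>, which
  is infinite iff the state \<open>0\<close>, hence by irreducibility every state, is recurrent.

  The moment identity passes to the limit from the truncations, once these are known to have a full
  set of real eigenvalues. This follows from the bidiagonal factorization by deflation: after scaling
  by the Perron eigenvector, taking differences of consecutive entries removes the Perron eigenvalue and
  turns the product of bidiagonal matrices into another such product, of size one less.
\<close>

section \<open>Perron eigenvectors of tridiagonally positive matrices\<close>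

text \<open>The full real spectrum serves two purposes: it makes \<open>ev\<close> a genuine
  enumeration, and it makes the biorthonormal family of eigenvectors complete, so that finite
  spectral sums reproduce powers of T. Such spectra usually come from oscillation theory of totally
  positive matrices; here Perron theory is the only input, and the induction on the size runs over
  all lists of positive bidiagonal factors that contain both kinds. Distinctness is the delicate
  point: the Perron value must not recur in the deflated spectrum, and this holds because it has no
  generalized eigenvectors. The (0,0) entry of the k-th power does not feel the truncation once
  \<open>k * q \<le> N\<close>, so every moment is eventually constant in N, and weak convergence on
  a compact interval carries it to the limit.\<close>

definition mv :: "nat \<Rightarrow> smat \<Rightarrow> (nat \<Rightarrow> real) \<Rightarrow> nat \<Rightarrow> real" where
  "mv n A x i = (\<Sum>l<n. A i l * x l)"

text \<open>Strong enough to make the n-th power entrywise positive, and stable under deflation: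
  every product with a lower and an upper factor has this property.\<close>

definition tridiagonally_positive :: "nat \<Rightarrow> smat \<Rightarrow> bool" where
  "tridiagonally_positive n A \<longleftrightarrow>
     (\<forall>i<n. \<forall>j<n. 0 \<le> A i j \<and> (i \<le> Suc j \<and> j \<le> Suc i \<longrightarrow> 0 < A i j))"

lemma mv_cong: "(\<And>l. l < n \<Longrightarrow> x l = y l) \<Longrightarrow> mv n A x = mv n A y"
  by (simp add: mv_def fun_eq_iff)

lemma mv_combine: "mv n A (\<lambda>i. a * x i + b * y i) j = a * mv n A x j + b * mv n A y j"
  by (simp add: mv_def algebra_simps sum.distrib sum_distrib_left)

lemma mv_funpow_combine:
  "(mv n A ^^ k) (\<lambda>i. a * x i + b * y i) = (\<lambda>j. a * (mv n A ^^ k) x j + b * (mv n A ^^ k) y j)"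
proof (induction k)
  case (Suc k)
  then show ?case by (simp add: mv_combine)
qed simp

lemma mv_funpow_nonneg:
  assumes "tridiagonally_positive n A" "\<And>i. i < n \<Longrightarrow> 0 \<le> x i" "j < n"
  shows "0 \<le> (mv n A ^^ k) x j"
  using assms(3)
proof (induction k arbitrary: j)
  case (Suc k)
  then show ?case
    using assms(1) by (auto simp: mv_def tridiagonally_positive_def intro!: sum_nonneg)
qed (use assms in simp)

text \<open>Each multiplication by A carries positivity to the neighbouring indices, so k of them
  carry it over distance k.\<close>

lemma mv_funpow_pos:
  assumes A: "tridiagonally_positive n A" and x: "\<And>i. i < n \<Longrightarrow> 0 \<le> x i" and i: "i < n" "0 < x i"
    and "j < n" "i \<le> j + k" "j \<le> i + k"
  shows "0 < (mv n A ^^ k) x j"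
  using assms(5-)
proof (induction k arbitrary: j)
  case 0
  then show ?case using i by simp
next
  case (Suc k)
  \<comment> \<open>The neighbour of \<open>j\<close> that is one step closer to
    \<open>i\<close>.\<close>
  define l where "l = (if i < j then j - 1 else if j < i then Suc j else j)"
  have l: "l < n" "i \<le> l + k" "l \<le> i + k" "j \<le> Suc l" "l \<le> Suc j"
    using Suc.prems i unfolding l_def by (auto split: if_splits)
  have "0 < A j l * (mv n A ^^ k) x l"
    using A l Suc.IH[OF l(1-3)] Suc.prems unfolding tridiagonally_positive_def by simp
  also have "\<dots> \<le> (\<Sum>m<n. A j m * (mv n A ^^ k) x m)"
    using l(1) Suc.prems A mv_funpow_nonneg[OF A x]
    by (intro member_le_sum) (auto simp: tridiagonally_positive_def)
  finally show ?case by (simp add: mv_def[of n A "(mv n A ^^ k) x"])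
qed

lemma mv_funpow_commute:
  "(mv n A ^^ k) (mv n A x) = mv n A ((mv n A ^^ k) x)"
  by (metis funpow_swap1)

lemma mv_funpow_eigen:
  assumes "\<And>i. i < n \<Longrightarrow> mv n A x i = r * x i" "i < n"
  shows "(mv n A ^^ k) x i = r ^ k * x i"
  using assms(2)
proof (induction k arbitrary: i)
  case (Suc k)
  have "mv n A ((mv n A ^^ k) x) = mv n A (\<lambda>i. r ^ k * x i + 0 * x i)"
    by (rule mv_cong) (simp add: Suc)
  then show ?case using Suc.prems assms(1) by (simp only: mv_combine funpow.simps o_def) simp
qed simp

text \<open>n multiplications spread one positive entry to all indices, but on an eigenvector they
  merely multiply by \<open>r ^ n\<close>; hence no entry can be 0.\<close>

lemma eigenvector_pos:
  assumes A: "tridiagonally_positive n A" and x: "\<And>i. i < n \<Longrightarrow> 0 \<le> x i" and i: "i < n" "0 < x i"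
    and ev: "\<And>i. i < n \<Longrightarrow> mv n A x i = r * x i" and j: "j < n"
  shows "0 < x j"
proof -
  have "0 < (mv n A ^^ n) x j"
    using i j by (intro mv_funpow_pos[where i = i] A x) auto
  also have "\<dots> = r ^ n * x j" by (rule mv_funpow_eigen[OF ev j])
  finally have "x j \<noteq> 0" by auto
  then show ?thesis using x[OF j] by simp
qed

text \<open>Collatz--Wielandt: the largest \<open>r\<close> with \<open>r x \<le> A x\<close> for some probability vector \<open>x\<close>.\<close>

lemma perron:
  assumes A: "tridiagonally_positive n A" and n: "0 < n"
  shows "\<exists>r v. 0 < r \<and> (\<forall>i<n. 0 < v i \<and> mv n A v i = r * v i)"
proof -
  \<comment> \<open>Summing \<open>r * x i \<le> mv n A x i\<close> over a probability vector bounds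
    \<open>r\<close> by the sum of all entries, which makes the set \<open>S\<close> of feasible
    pairs compact.\<close>
  define C where "C = (\<Sum>i<n. \<Sum>l<n. A i l)"
  \<comment> \<open>Vectors are functions that vanish from \<open>n\<close> on, so compactness comes
    from Tychonoff's theorem.\<close>
  define K where "K = (PiE UNIV (\<lambda>i. if i < n then {0..1} else {0}) :: (nat \<Rightarrow> real) set)"
  define S where "S = ({0..C} \<times> K) \<inter> {z. (\<Sum>i<n. snd z i) = 1} \<inter>
     (\<Inter>i\<in>{..<n}. {z. fst z * snd z i \<le> mv n A (snd z) i})"
  have Apos: "0 \<le> A i j" if "i < n" "j < n" for i j
    using A that by (simp add: tridiagonally_positive_def)
  have "compact K"
    unfolding K_def compactin_euclidean_iff[symmetric] euclidean_product_topology[symmetric]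
    by (subst compactin_PiE) auto
  then have "compact ({0..C} \<times> K)" by (intro compact_Times) auto
  have cont: "continuous_on UNIV (\<lambda>z :: real \<times> (nat \<Rightarrow> real). snd z i)" for i
    by (rule continuous_on_product_then_coordinatewise) (intro continuous_intros)
  have "closed {z :: real \<times> (nat \<Rightarrow> real). (\<Sum>i<n. snd z i) = 1}"
    by (intro closed_Collect_eq continuous_intros cont)
  moreover have "closed {z :: real \<times> (nat \<Rightarrow> real). fst z * snd z i \<le> mv n A (snd z) i}" for i
    unfolding mv_def by (intro closed_Collect_le continuous_intros cont)
  ultimately have "compact S"
    unfolding S_def using \<open>compact ({0..C} \<times> K)\<close> by (intro compact_Int_closed closed_INT) auto
  have memS: "(r, x) \<in> S" if "0 \<le> r" "\<And>i. i < n \<Longrightarrow> 0 \<le> x i" "\<And>i. i \<ge> n \<Longrightarrow> x i = 0"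
    "(\<Sum>i<n. x i) = 1" "\<And>i. i < n \<Longrightarrow> r * x i \<le> mv n A x i" for r x
  proof -
    have le1: "x i \<le> 1" if "i < n" for i
      using \<open>(\<Sum>i<n. x i) = 1\<close> member_le_sum[of i "{..<n}" x] that \<open>\<And>i. i < n \<Longrightarrow> 0 \<le> x i\<close> by simp
    have "r = (\<Sum>i<n. r * x i)" using that(4) by (simp add: sum_distrib_left[symmetric])
    also have "\<dots> \<le> (\<Sum>i<n. mv n A x i)" using that(5) by (intro sum_mono) auto
    also have "\<dots> \<le> C"
      unfolding C_def mv_def using Apos le1 that(2)
      by (intro sum_mono) (auto intro!: mult_right_le_one_le)
    finally show ?thesis using that le1 unfolding S_def K_def by (auto simp: PiE_iff)
  qed
  have "(0, \<lambda>i. if i = 0 then 1 else 0) \<in> S"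
    using n Apos by (intro memS) (auto simp: mv_def if_distrib cong: if_cong)
  then obtain r x where rx: "(r, x) \<in> S" and max: "\<And>z. z \<in> S \<Longrightarrow> fst z \<le> r"
    using continuous_attains_sup[OF \<open>compact S\<close>, of fst] by (fastforce intro: continuous_intros)
  have r: "0 \<le> r" and x: "\<And>i. i < n \<Longrightarrow> 0 \<le> x i" "(\<Sum>i<n. x i) = 1"
    and le: "\<And>i. i < n \<Longrightarrow> r * x i \<le> mv n A x i"
    using rx unfolding S_def K_def by (auto simp: PiE_iff split: if_splits)
  have "\<exists>i<n. 0 < x i"
  proof (rule ccontr)
    assume "\<not> ?thesis"
    then have "sum x {..<n} \<le> 0" by (intro sum_nonpos) (metis lessThan_iff not_less)
    then show False using x by simp
  qed
  then obtain i0 where i0: "i0 < n" "0 < x i0" by auto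
  let ?H = "mv n A ^^ n"
  define y where "y = ?H x"
  have y: "0 < y j" if "j < n" for j
    unfolding y_def by (rule mv_funpow_pos[where i = i0]) (use A x i0 that in auto)
  \<comment> \<open>If some slack were positive, n further multiplications would make it positive
    everywhere, and \<open>y\<close> would admit a factor larger than the maximal
    \<open>r\<close>.\<close>
  have eq: "mv n A x i = r * x i" if "i < n" for i
  proof (rule ccontr)
    assume "mv n A x i \<noteq> r * x i"
    define d where "d j = 1 * mv n A x j + (- r) * x j" for j
    have d: "0 \<le> d j" if "j < n" for j using le[OF that] by (simp add: d_def)
    have "0 < d i" using le[OF \<open>i < n\<close>] \<open>mv n A x i \<noteq> r * x i\<close> by (simp add: d_def)
    have Hd: "?H d j = mv n A y j - r * y j" for j
      unfolding d_def[abs_def] mv_funpow_combine y_def by (simp add: mv_funpow_commute)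
    have gap: "r * y j < mv n A y j" if "j < n" for j
    proof -
      have "0 < ?H d j"
        by (rule mv_funpow_pos[where i = i]) (use A d \<open>i < n\<close> \<open>0 < d i\<close> that in auto)
      then show ?thesis by (simp add: Hd)
    qed
    \<comment> \<open>The largest factor that \<open>y\<close> admits; it exceeds \<open>r\<close>
      because the inequality is strict in each of finitely many entries.\<close>
    define e where "e = Min ((\<lambda>j. mv n A y j / y j) ` {..<n})"
    have ne: "{..<n} \<noteq> {}" using n by auto
    have "r < e" unfolding e_def using n gap y by (subst Min_gr_iff) (auto simp: field_simps)
    have e: "e * y j \<le> mv n A y j" if "j < n" for j
    proof -
      have "e \<le> mv n A y j / y j" unfolding e_def using that by (intro Min_le) auto
      then show ?thesis using y[OF that] by (simp add: field_simps)
    qed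
    define s where "s = (\<Sum>i<n. y i)"
    have s: "0 < s" unfolding s_def using y ne by (intro sum_pos) auto
    define z where "z j = (if j < n then y j / s else 0)" for j
    have "mv n A z j = mv n A y j / s" for j
      by (simp add: mv_def z_def sum_divide_distrib)
    then have "(e, z) \<in> S"
      using \<open>r < e\<close> r y e s
      by (intro memS)
        (auto simp: z_def less_imp_le sum_divide_distrib[symmetric] s_def[symmetric] divide_right_mono)
    then show False using max[of "(e, z)"] \<open>r < e\<close> by simp
  qed
  have pos: "0 < x j" if "j < n" for j 
    by (rule eigenvector_pos[where i = i0]) (use A x i0 eq that in auto)
  have "r \<noteq> 0"
  proof
    assume "r = 0"
    have "0 < A i0 i0 * x i0" using A i0 by (simp add: tridiagonally_positive_def)
    also have "\<dots> \<le> mv n A x i0"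
      unfolding mv_def using Apos x i0 by (intro member_le_sum) auto
    finally show False using eq[OF i0(1)] \<open>r = 0\<close> by simp
  qed
  then show ?thesis using r pos eq by (intro exI[of _ r] exI[of _ x]) auto
qed

text \<open>Excludes Jordan blocks at the Perron value. Subtract \<open>x\<close> from the least
  multiple of \<open>v\<close> above it: the difference \<open>z x\<close> is nonnegative and has a
  zero entry, where the equation forces \<open>c \<le> 0\<close>. By symmetry \<open>c = 0\<close>,
  so \<open>z x\<close> satisfies the eigenvector equation with a zero entry and must
  vanish.\<close>

lemma perron_generalized_simple:
  assumes A: "tridiagonally_positive n A" and n: "0 < n"
    and v: "\<And>i. i < n \<Longrightarrow> 0 < v i" and ev: "\<And>i. i < n \<Longrightarrow> mv n A v i = r * v i"
    and x: "\<And>i. i < n \<Longrightarrow> mv n A x i = r * x i + c * v i"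
  shows "\<exists>k. \<forall>i<n. x i = k * v i"
proof -
  define touch where "touch x = Max ((\<lambda>i. x i / v i) ` {..<n})" for x
  have ne: "{..<n} \<noteq> {}" using n by auto
  have touch: "x i \<le> touch x * v i" if "i < n" for x i
  proof -
    have "x i / v i \<le> touch x" unfolding touch_def using that by (intro Max_ge) auto
    then show ?thesis using v[OF that] by (simp add: field_simps)
  qed
  have touching: "\<exists>i<n. x i = touch x * v i" for x
  proof -
    have "touch x \<in> (\<lambda>i. x i / v i) ` {..<n}"
      unfolding touch_def using ne by (intro Max_in) auto
    then obtain i where "i < n" "touch x = x i / v i" by auto
    then show ?thesis using v[of i] by (intro exI[of _ i]) auto
  qed
  define z where "z x i = touch x * v i + (- 1) * x i" for x i
  have z0: "0 \<le> z x i" if "i < n" for x i using touch[OF that, of x] by (simp add: z_def)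
  have mvz: "mv n A (z x) i = r * z x i - c * v i"
    if "\<And>i. i < n \<Longrightarrow> mv n A x i = r * x i + c * v i" "i < n" for x c i
    unfolding z_def[abs_def] mv_combine by (simp add: that ev algebra_simps)
  have c: "c \<le> 0" if eq: "\<And>i. i < n \<Longrightarrow> mv n A x i = r * x i + c * v i" for x c
  proof -
    obtain i where i: "i < n" "x i = touch x * v i" using touching by blast
    have "0 \<le> mv n A (z x) i"
      using A i z0 by (auto simp: mv_def tridiagonally_positive_def intro!: sum_nonneg)
    also have "\<dots> = - (c * v i)" using mvz[OF eq i(1)] i by (simp add: z_def)
    finally show ?thesis using v[OF i(1)] by (simp add: mult_le_0_iff)
  qed
  \<comment> \<open>For \<open>- x\<close> the constant is \<open>- c\<close>, which yields the
    opposite inequality.\<close>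
  have "mv n A (\<lambda>i. - x i) i = r * - x i + - c * v i" if "i < n" for i
    using x[OF that] mv_combine[of n A "-1" x 0 x i] by simp
  from c[OF x] c[OF this] have "c = 0" by simp
  obtain i where i: "i < n" "x i = touch x * v i" using touching by blast
  have "z x j = 0" if "j < n" for j
  proof (rule ccontr)
    assume "z x j \<noteq> 0"
    then have "0 < z x j" using z0[OF that, of x] by simp
    then have "0 < z x i"
      using mvz[OF x] \<open>c = 0\<close> by (intro eigenvector_pos[of n A "z x" j r i] A z0 that i) auto
    then show False using i by (simp add: z_def)
  qed
  then show ?thesis by (intro exI[of _ "touch x"]) (simp add: z_def)
qed

section \<open>Products of bidiagonal matrices\<close>

text \<open>Every factor is cut to its leading block of size \<open>n\<close> before multiplying,
  whereas \<open>leading_block\<close> cuts the infinite product;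
  \<open>factorization_truncation\<close> reconciles the two.\<close>

definition trunc_prod :: "nat \<Rightarrow> smat list \<Rightarrow> smat" where
  "trunc_prod n Ms = foldr (\<lambda>A B i j. \<Sum>k<n. A i k * B k j) Ms smat_one"

lemma mv_trunc_prod_Nil: "i < n \<Longrightarrow> mv n (trunc_prod n []) x i = x i"
  by (simp add: mv_def trunc_prod_def smat_one_def if_distrib[of "\<lambda>a. a * _"] cong: if_cong)

lemma mv_trunc_prod_Cons: "mv n (trunc_prod n (M # Ms)) x = mv n M (mv n (trunc_prod n Ms) x)"
proof
  fix i
  have "mv n (trunc_prod n (M # Ms)) x i = (\<Sum>l<n. \<Sum>k<n. M i k * (trunc_prod n Ms k l * x l))"
    by (simp add: mv_def trunc_prod_def sum_distrib_right mult.assoc)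
  also have "\<dots> = (\<Sum>k<n. \<Sum>l<n. M i k * (trunc_prod n Ms k l * x l))"
    by (rule sum.swap)
  finally show "mv n (trunc_prod n (M # Ms)) x i = mv n M (mv n (trunc_prod n Ms) x) i"
    by (simp add: mv_def sum_distrib_left)
qed

lemma pos_upper_bidiagonalD:
  assumes "pos_upper_bidiagonal M"
  shows "0 < M i i" "0 < M i (Suc i)" "M i j \<noteq> 0 \<Longrightarrow> j = i \<or> j = Suc i"
proof -
  have *: "if m = n \<or> m = Suc n then 0 < M n m else M n m = 0" for n m
    using assms unfolding pos_upper_bidiagonal_def by blast
  show "0 < M i i" "0 < M i (Suc i)" "M i j \<noteq> 0 \<Longrightarrow> j = i \<or> j = Suc i"
    using *[where n = i and m = i] *[where n = i and m = "Suc i"] *[where n = i and m = j]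
    by (auto split: if_splits)
qed

lemma pos_lower_bidiagonalD:
  assumes "pos_lower_bidiagonal M"
  shows "0 < M i i" "0 < M (Suc i) i" "0 < i \<Longrightarrow> 0 < M i (i - 1)"
    "M i j \<noteq> 0 \<Longrightarrow> i = j \<or> i = Suc j"
proof -
  have *: "if n = m \<or> n = Suc m then 0 < M n m else M n m = 0" for n m
    using assms unfolding pos_lower_bidiagonal_def by blast
  show "0 < M i i" "0 < M (Suc i) i" "0 < i \<Longrightarrow> 0 < M i (i - 1)"
    "M i j \<noteq> 0 \<Longrightarrow> i = j \<or> i = Suc j"
    using *[where n = i and m = i] *[where n = "Suc i" and m = i] *[where n = i and m = "i - 1"]
      *[where n = i and m = j]
    by (auto split: if_splits)
qed

lemma mv_upper:
  assumes "pos_upper_bidiagonal M" "i < n"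
  shows "mv n M x i = M i i * x i + (if Suc i < n then M i (Suc i) * x (Suc i) else 0)"
proof -
  have "mv n M x i = (\<Sum>l\<in>{i, Suc i} \<inter> {..<n}. M i l * x l)"
    unfolding mv_def using assms
    by (intro sum.mono_neutral_right) (auto dest: pos_upper_bidiagonalD(3))
  also have "{i, Suc i} \<inter> {..<n} = (if Suc i < n then {i, Suc i} else {i})"
    using assms by auto
  finally show ?thesis by simp
qed

lemma mv_lower:
  assumes "pos_lower_bidiagonal M" "i < n"
  shows "mv n M x i = M i i * x i + (if 0 < i then M i (i - 1) * x (i - 1) else 0)"
proof -
  have "mv n M x i = (\<Sum>l\<in>(if 0 < i then {i, i - 1} else {i}). M i l * x l)"
    unfolding mv_def using assms
    by (intro sum.mono_neutral_right)
       (auto dest: pos_lower_bidiagonalD(4) split: if_splits)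
  then show ?thesis by simp
qed

text \<open>
  If \<open>v\<close> is scaled to the constant vector, a bidiagonal factor becomes stochastic, and the
  differences of a vector are transformed by a bidiagonal matrix of size one less.
\<close>

lemma deflate_upper:
  assumes M: "pos_upper_bidiagonal M" and v: "\<And>i. i < Suc n \<Longrightarrow> 0 < v i"
  defines "w \<equiv> mv (Suc n) M v"
  shows "\<exists>M'. pos_upper_bidiagonal M' \<and> (\<forall>x. \<forall>i<n.
    mv (Suc n) M x (Suc i) / w (Suc i) - mv (Suc n) M x i / w i =
    mv n M' (\<lambda>j. x (Suc j) / v (Suc j) - x j / v j) i)"
proof -
  \<comment> \<open>\<open>d\<close> and \<open>c\<close> are the entries of diag(w)^-1 M diag(v),
    whose rows sum to 1 because w = M v. The last truncated row has no superdiagonal entry, hence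
    \<open>c n = 0\<close>.\<close>
  define d where "d i = M i i * v i / w i" for i
  define c where "c i = (if i < n then M i (Suc i) * v (Suc i) / w i else 0)" for i
  \<comment> \<open>Row i+1 minus row i, written in the increments of \<open>X\<close>: the weight
    is \<open>d i\<close> on the i-th and \<open>c (Suc i)\<close> on the next. The entries 1
    outside the block are fillers that keep \<open>M'\<close> positive bidiagonal.\<close>
  define M' where "M' i j = (if i = j then if i < n then d i else 1
    else if j = Suc i then if Suc i < n then c (Suc i) else 1 else 0)" for i j
  have Mpos: "0 < M i i" "0 < M i (Suc i)" for i
    using pos_upper_bidiagonalD[OF M] by auto
  have w: "0 < w i" "w i = M i i * v i + (if i < n then M i (Suc i) * v (Suc i) else 0)"
    if "i < Suc n" for i
    using that v Mpos by (auto simp: w_def mv_upper[OF M] intro!: add_pos_pos)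
  have dc: "d i + c i = 1" if "i < Suc n" for i
  proof -
    have "d i + c i = (M i i * v i + (if i < n then M i (Suc i) * v (Suc i) else 0)) / w i"
      by (simp add: d_def c_def add_divide_distrib)
    also have "\<dots> = w i / w i" by (simp only: w(2)[OF that, symmetric])
    finally have "d i + c i = w i / w i" .
    then show ?thesis using w(1)[OF that] by simp
  qed
  have "0 < d i" if "i < Suc n" for i
    using w(1) v Mpos that by (simp add: d_def)
  moreover have "0 < c i" if "i < n" for i
    using w(1) v Mpos that by (simp add: c_def)
  ultimately have M': "pos_upper_bidiagonal M'"
    unfolding pos_upper_bidiagonal_def M'_def by auto
  have "mv (Suc n) M x (Suc i) / w (Suc i) - mv (Suc n) M x i / w i =
    mv n M' (\<lambda>j. x (Suc j) / v (Suc j) - x j / v j) i" if "i < n" for x i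
  proof -
    define X where "X j = x j / v j" for j
    have X: "mv (Suc n) M x j / w j = d j * X j + c j * X (Suc j)" if "j < Suc n" for j
    proof -
      have "v j \<noteq> 0" "j < n \<Longrightarrow> v (Suc j) \<noteq> 0" using v[of j] v[of "Suc j"] that by auto
      then show ?thesis
        using that by (cases "j < n") (simp_all add: mv_upper[OF M] d_def c_def X_def add_divide_distrib)
    qed
    have E: "mv n M' (\<lambda>j. X (Suc j) - X j) i = d i * (X (Suc i) - X i)
        + c (Suc i) * (X (Suc (Suc i)) - X (Suc i))"
      using that by (simp add: mv_upper[OF M'] M'_def) (simp add: c_def)
    have dc': "d i = 1 - c i" "d (Suc i) = 1 - c (Suc i)"
      using dc[of i] dc[of "Suc i"] that by auto
    have "mv (Suc n) M x i / w i = d i * X i + c i * X (Suc i)"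
      "mv (Suc n) M x (Suc i) / w (Suc i) = d (Suc i) * X (Suc i) + c (Suc i) * X (Suc (Suc i))"
      using X[of i] X[of "Suc i"] that by auto
    then show ?thesis
      by (simp only: X_def[symmetric] E dc') (simp add: algebra_simps)
  qed
  with M' show ?thesis by blast
qed

lemma deflate_lower:
  assumes M: "pos_lower_bidiagonal M" and v: "\<And>i. i < Suc n \<Longrightarrow> 0 < v i"
  defines "w \<equiv> mv (Suc n) M v"
  shows "\<exists>M'. pos_lower_bidiagonal M' \<and> (\<forall>x. \<forall>i<n.
    mv (Suc n) M x (Suc i) / w (Suc i) - mv (Suc n) M x i / w i =
    mv n M' (\<lambda>j. x (Suc j) / v (Suc j) - x j / v j) i)"
proof -
  define d where "d i = M i i * v i / w i" for i
  define c where "c i = (if 0 < i then M i (i - 1) * v (i - 1) / w i else 0)" for i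
  \<comment> \<open>Now the weights are \<open>d (Suc i)\<close> on the i-th increment and
    \<open>c i\<close> on the preceding one, so the shifted index falls on the diagonal.\<close>
  define M' where "M' i j = (if i = j then if i < n then d (Suc i) else 1
    else if i = Suc j then if i < n then c i else 1 else 0)" for i j
  have Mpos: "0 < M i i" "0 < i \<Longrightarrow> 0 < M i (i - 1)" for i
    using pos_lower_bidiagonalD[OF M] by auto
  have w: "0 < w i" "w i = M i i * v i + (if 0 < i then M i (i - 1) * v (i - 1) else 0)"
    if "i < Suc n" for i
    using that v[of i] v[of "i - 1"] Mpos[of i]
    by (auto simp: w_def mv_lower[OF M] intro!: add_pos_pos)
  have dc: "d i + c i = 1" if "i < Suc n" for i
  proof -
    have "d i + c i = (M i i * v i + (if 0 < i then M i (i - 1) * v (i - 1) else 0)) / w i"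
      by (simp add: d_def c_def add_divide_distrib)
    also have "\<dots> = w i / w i" by (simp only: w(2)[OF that, symmetric])
    finally have "d i + c i = w i / w i" .
    then show ?thesis using w(1)[OF that] by simp
  qed
  have "0 < d i" if "i < Suc n" for i
    using w(1) v Mpos that by (simp add: d_def)
  moreover have "0 < c i" if "i < n" "0 < i" for i
    using w(1) v Mpos that by (simp add: c_def)
  ultimately have M': "pos_lower_bidiagonal M'"
    unfolding pos_lower_bidiagonal_def M'_def by auto
  have "mv (Suc n) M x (Suc i) / w (Suc i) - mv (Suc n) M x i / w i =
    mv n M' (\<lambda>j. x (Suc j) / v (Suc j) - x j / v j) i" if "i < n" for x i
  proof -
    define X where "X j = x j / v j" for j
    \<comment> \<open>At \<open>j = 0\<close> the term \<open>X (j - 1)\<close> is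
      \<open>X 0\<close>, which is harmless because \<open>c 0 = 0\<close>.\<close>
    have X: "mv (Suc n) M x j / w j = d j * X j + c j * X (j - 1)" if "j < Suc n" for j
    proof -
      have "v j \<noteq> 0" "v (j - 1) \<noteq> 0" 
        using v[of j] v[of "j - 1"] that by (simp_all add: less_imp_diff_less less_imp_neq[symmetric] del: One_nat_def)
      then show ?thesis
        using that by (simp add: mv_lower[OF M] d_def c_def X_def add_divide_distrib)
    qed
    have E: "mv n M' (\<lambda>j. X (Suc j) - X j) i = d (Suc i) * (X (Suc i) - X i) + c i * (X i - X (i - 1))"
      using that by (cases i) (simp_all add: mv_lower[OF M'] M'_def c_def)
    have dc': "d i = 1 - c i" "d (Suc i) = 1 - c (Suc i)"
      using dc[of i] dc[of "Suc i"] that by auto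
    have "mv (Suc n) M x i / w i = d i * X i + c i * X (i - 1)"
      "mv (Suc n) M x (Suc i) / w (Suc i) = d (Suc i) * X (Suc i) + c (Suc i) * X i"
      using X[of i] X[of "Suc i"] that by auto
    then show ?thesis
      by (simp only: X_def[symmetric] E dc') (simp add: algebra_simps)
  qed
  with M' show ?thesis by blast
qed

lemma mv_bidiagonal_pos:
  assumes "pos_lower_bidiagonal M \<or> pos_upper_bidiagonal M" "\<And>i. i < n \<Longrightarrow> 0 < v i" "i < n"
  shows "0 < mv n M v i"
  using assms(1)
proof
  assume M: "pos_lower_bidiagonal M"
  from pos_lower_bidiagonalD[OF M] show ?thesis using assms by (auto simp: mv_lower[OF M] intro!: add_pos_pos)
next
  assume M: "pos_upper_bidiagonal M"
  from pos_upper_bidiagonalD[OF M] show ?thesis using assms by (auto simp: mv_upper[OF M] intro!: add_pos_pos)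
qed

section \<open>Deflation and positivity of whole products\<close>

lemma mv_trunc_prod_pos:
  assumes "\<forall>M\<in>set Ms. pos_lower_bidiagonal M \<or> pos_upper_bidiagonal M"
    "\<And>i. i < n \<Longrightarrow> 0 < v i" "i < n"
  shows "0 < mv n (trunc_prod n Ms) v i"
  using assms(1,3)
proof (induction Ms arbitrary: i)
  case Nil
  then show ?case using assms(2) by (simp add: mv_trunc_prod_Nil)
next
  case (Cons M Ms)
  then show ?case unfolding mv_trunc_prod_Cons by (intro mv_bidiagonal_pos[of M]) auto
qed

text \<open>The factors are scaled in a chain: each takes as input scaling the image of
  \<open>v\<close> under the factors to its right, and its output scaling feeds the next, so the
  single deflations compose. The kinds of the factors are recorded because Perron theory must apply
  again to the smaller product.\<close>

lemma deflate_trunc_prod: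
  assumes "\<forall>M\<in>set Ms. pos_lower_bidiagonal M \<or> pos_upper_bidiagonal M"
    and v: "\<forall>i<Suc n. 0 < v i"
  shows "\<exists>Ms'. (\<forall>M\<in>set Ms'. pos_lower_bidiagonal M \<or> pos_upper_bidiagonal M) \<and>
    ((\<exists>M\<in>set Ms. pos_lower_bidiagonal M) \<longrightarrow> (\<exists>M\<in>set Ms'. pos_lower_bidiagonal M)) \<and>
    ((\<exists>M\<in>set Ms. pos_upper_bidiagonal M) \<longrightarrow> (\<exists>M\<in>set Ms'. pos_upper_bidiagonal M)) \<and>
    (\<forall>x. \<forall>i<n. mv (Suc n) (trunc_prod (Suc n) Ms) x (Suc i) / mv (Suc n) (trunc_prod (Suc n) Ms) v (Suc i)
          - mv (Suc n) (trunc_prod (Suc n) Ms) x i / mv (Suc n) (trunc_prod (Suc n) Ms) v i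
        = mv n (trunc_prod n Ms') (\<lambda>j. x (Suc j) / v (Suc j) - x j / v j) i)"
  using assms(1)
proof (induction Ms)
  case Nil
  then show ?case by (intro exI[of _ "[]"]) (simp add: mv_trunc_prod_Nil)
next
  case (Cons M Ms)
  let ?P = "mv (Suc n) (trunc_prod (Suc n) Ms)"
  let ?rel = "\<lambda>M M'. (pos_lower_bidiagonal M \<longrightarrow> pos_lower_bidiagonal M') \<and>
        (pos_upper_bidiagonal M \<longrightarrow> pos_upper_bidiagonal M')"
  obtain Ms' where Ms': "(\<forall>M\<in>set Ms'. pos_lower_bidiagonal M \<or> pos_upper_bidiagonal M) \<and>
    ((\<exists>M\<in>set Ms. pos_lower_bidiagonal M) \<longrightarrow> (\<exists>M\<in>set Ms'. pos_lower_bidiagonal M)) \<and>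
    ((\<exists>M\<in>set Ms. pos_upper_bidiagonal M) \<longrightarrow> (\<exists>M\<in>set Ms'. pos_upper_bidiagonal M))"
    and eq: "\<And>x i. i < n \<Longrightarrow> ?P x (Suc i) / ?P v (Suc i) - ?P x i / ?P v i
        = mv n (trunc_prod n Ms') (\<lambda>j. x (Suc j) / v (Suc j) - x j / v j) i"
    using Cons by auto
  have Pv: "0 < ?P v i" if "i < Suc n" for i
    using mv_trunc_prod_pos[of Ms "Suc n" v i] v that Cons.prems by simp
  \<comment> \<open>No matrix is of both kinds, so one implication of \<open>?rel\<close> is always
    vacuous and a single deflation lemma provides \<open>M'\<close>.\<close>
  have "\<not> (pos_lower_bidiagonal M \<and> pos_upper_bidiagonal M)"
    using pos_upper_bidiagonalD(2)[of M 0] pos_lower_bidiagonalD(4)[of M 0 1] by auto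
  then have "\<exists>M'. ?rel M M' \<and> (\<forall>x. \<forall>i<n. mv (Suc n) M x (Suc i) / mv (Suc n) M (?P v) (Suc i)
      - mv (Suc n) M x i / mv (Suc n) M (?P v) i
      = mv n M' (\<lambda>j. x (Suc j) / ?P v (Suc j) - x j / ?P v j) i)"
    using deflate_upper[of M n "?P v", OF _ Pv] deflate_lower[of M n "?P v", OF _ Pv]
      Cons.prems by (cases "pos_upper_bidiagonal M") auto
  then obtain M' where "?rel M M'"
    and M': "\<And>x i. i < n \<Longrightarrow> mv (Suc n) M x (Suc i) / mv (Suc n) M (?P v) (Suc i)
      - mv (Suc n) M x i / mv (Suc n) M (?P v) i
      = mv n M' (\<lambda>j. x (Suc j) / ?P v (Suc j) - x j / ?P v j) i"
    by blast
  have "mv n M' (\<lambda>j. ?P x (Suc j) / ?P v (Suc j) - ?P x j / ?P v j) =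
      mv n M' (mv n (trunc_prod n Ms') (\<lambda>j. x (Suc j) / v (Suc j) - x j / v j))" for x
    by (rule mv_cong) (rule eq)
  then show ?case
    using Ms' \<open>?rel M M'\<close> M' Cons.prems
    by (intro exI[of _ "M' # Ms'"]) (auto simp: mv_trunc_prod_Cons)
qed

lemma trunc_prod_Cons_ge:
  assumes "\<And>i j. 0 \<le> M i j" "\<And>k j. 0 \<le> trunc_prod n Ms k j" "k < n"
  shows "M i k * trunc_prod n Ms k j \<le> trunc_prod n (M # Ms) i j"
proof -
  have "M i k * trunc_prod n Ms k j \<le> (\<Sum>k<n. M i k * trunc_prod n Ms k j)"
    using assms by (intro member_le_sum) auto
  then show ?thesis by (simp add: trunc_prod_def)
qed

lemma bidiagonal_entries:
  assumes "pos_lower_bidiagonal M \<or> pos_upper_bidiagonal M"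
  shows "0 \<le> M i j" "0 < M i i"
proof -
  show "0 < M i i" using assms by (auto simp: pos_lower_bidiagonalD pos_upper_bidiagonalD)
  show "0 \<le> M i j"
    using assms pos_lower_bidiagonalD[of M] pos_upper_bidiagonalD[of M]
    by (metis less_eq_real_def)
qed

lemma trunc_prod_nonneg:
  assumes "\<forall>M\<in>set Ms. pos_lower_bidiagonal M \<or> pos_upper_bidiagonal M"
  shows "0 \<le> trunc_prod n Ms i j"
  using assms
proof (induction Ms arbitrary: i j)
  case (Cons M Ms)
  then show ?case using bidiagonal_entries(1)[of M] by (simp add: trunc_prod_def sum_nonneg)
qed (simp add: trunc_prod_def smat_one_def)

lemma trunc_prod_diag_pos:
  assumes "\<forall>M\<in>set Ms. pos_lower_bidiagonal M \<or> pos_upper_bidiagonal M" "i < n"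
  shows "0 < trunc_prod n Ms i i"
  using assms
proof (induction Ms)
  case (Cons M Ms)
  then have M: "pos_lower_bidiagonal M \<or> pos_upper_bidiagonal M" by simp
  have "0 < M i i * trunc_prod n Ms i i" using Cons bidiagonal_entries(2)[OF M] by simp
  also have "\<dots> \<le> trunc_prod n (M # Ms) i i"
    by (rule trunc_prod_Cons_ge) (use Cons bidiagonal_entries[OF M] trunc_prod_nonneg[of Ms] in auto)
  finally show ?case .
qed (simp add: trunc_prod_def smat_one_def)

text \<open>One factor makes the move from \<open>i\<close> to \<open>j\<close> and all others stay
  on their diagonals; this is one positive term in a sum of nonnegative ones.\<close>

lemma trunc_prod_off_diag_pos:
  assumes "\<forall>M\<in>set Ms. pos_lower_bidiagonal M \<or> pos_upper_bidiagonal M" "i < n" "j < n"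
    and "\<exists>M\<in>set Ms. 0 < M i j"
  shows "0 < trunc_prod n Ms i j"
  using assms
proof (induction Ms)
  case (Cons M Ms)
  then have M: "pos_lower_bidiagonal M \<or> pos_upper_bidiagonal M" by simp
  have Ms: "\<forall>M\<in>set Ms. pos_lower_bidiagonal M \<or> pos_upper_bidiagonal M" using Cons.prems by simp
  note ge = trunc_prod_Cons_ge[of M n Ms, OF bidiagonal_entries(1)[OF M] trunc_prod_nonneg[OF Ms]]
  show ?case
  proof (cases "0 < M i j")
    case True
    then have "0 < M i j * trunc_prod n Ms j j"
      using trunc_prod_diag_pos[OF Ms] Cons.prems by simp
    also have "\<dots> \<le> trunc_prod n (M # Ms) i j" using Cons.prems by (intro ge)
    finally show ?thesis .
  next
    case False
    then have "0 < M i i * trunc_prod n Ms i j"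
      using bidiagonal_entries(2)[OF M] Cons by simp
    also have "\<dots> \<le> trunc_prod n (M # Ms) i j" using Cons.prems by (intro ge)
    finally show ?thesis .
  qed
qed simp

lemma tridiagonally_positive_trunc_prod:
  assumes "\<forall>M\<in>set Ms. pos_lower_bidiagonal M \<or> pos_upper_bidiagonal M"
    "\<exists>M\<in>set Ms. pos_lower_bidiagonal M" "\<exists>M\<in>set Ms. pos_upper_bidiagonal M"
  shows "tridiagonally_positive n (trunc_prod n Ms)"
  unfolding tridiagonally_positive_def
proof (intro allI impI conjI)
  fix i j assume ij: "i < n" "j < n"
  show "0 \<le> trunc_prod n Ms i j" by (rule trunc_prod_nonneg[OF assms(1)])
  assume "i \<le> Suc j \<and> j \<le> Suc i"
  then consider "i = j" | "j = Suc i" | "i = Suc j" by linarith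
  then show "0 < trunc_prod n Ms i j"
  proof cases
    case 1
    then show ?thesis using trunc_prod_diag_pos[OF assms(1)] ij by simp
  next
    case 2
    then have "\<exists>M\<in>set Ms. 0 < M i j" using assms(3) pos_upper_bidiagonalD(2) by blast
    then show ?thesis by (rule trunc_prod_off_diag_pos[OF assms(1) ij])
  next
    case 3
    then have "\<exists>M\<in>set Ms. 0 < M i j" using assms(2) pos_lower_bidiagonalD(2) by blast
    then show ?thesis by (rule trunc_prod_off_diag_pos[OF assms(1) ij])
  qed
qed

section \<open>A full set of real eigenvalues by deflation\<close>

definition mv_eigenvalue :: "nat \<Rightarrow> smat \<Rightarrow> real \<Rightarrow> bool" where
  "mv_eigenvalue n A r \<longleftrightarrow> (\<exists>x. (\<exists>i<n. x i \<noteq> 0) \<and> (\<forall>i<n. mv n A x i = r * x i))"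

text \<open>With a Perron pair \<open>r\<close>, \<open>v\<close>, taking increments of x/v kills
  \<open>v\<close>, and A/r induces the deflated product on the increments. Thus an eigenvalue
  \<open>m\<close> of the latter lifts to \<open>r * m\<close>, and \<open>r\<close> itself is the
  additional eigenvalue.\<close>

lemma trunc_prod_eigenvalues:
  assumes "\<forall>M\<in>set Ms. pos_lower_bidiagonal M \<or> pos_upper_bidiagonal M"
    "\<exists>M\<in>set Ms. pos_lower_bidiagonal M" "\<exists>M\<in>set Ms. pos_upper_bidiagonal M"
  shows "\<exists>S. finite S \<and> card S = n \<and> (\<forall>r\<in>S. mv_eigenvalue n (trunc_prod n Ms) r)"
  using assms
proof (induction n arbitrary: Ms)
  case 0
  then show ?case by (intro exI[of _ "{}"]) simp
next
  case (Suc n)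
  define A where "A = trunc_prod (Suc n) Ms"
  have A: "tridiagonally_positive (Suc n) A"
    unfolding A_def by (rule tridiagonally_positive_trunc_prod[OF Suc.prems])
  obtain r v where r: "0 < r" and v: "\<And>i. i < Suc n \<Longrightarrow> 0 < v i"
    and ev: "\<And>i. i < Suc n \<Longrightarrow> mv (Suc n) A v i = r * v i"
    using perron[OF A] by auto
  have "\<forall>i<Suc n. 0 < v i" using v by simp
  from deflate_trunc_prod[OF Suc.prems(1) this, folded A_def]
  obtain Ms' where Ms': "\<forall>M\<in>set Ms'. pos_lower_bidiagonal M \<or> pos_upper_bidiagonal M"
      "(\<exists>M\<in>set Ms. pos_lower_bidiagonal M) \<longrightarrow> (\<exists>M\<in>set Ms'. pos_lower_bidiagonal M)"
      "(\<exists>M\<in>set Ms. pos_upper_bidiagonal M) \<longrightarrow> (\<exists>M\<in>set Ms'. pos_upper_bidiagonal M)"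
    and eq0: "\<forall>x. \<forall>i<n. mv (Suc n) A x (Suc i) / mv (Suc n) A v (Suc i)
          - mv (Suc n) A x i / mv (Suc n) A v i
        = mv n (trunc_prod n Ms') (\<lambda>j. x (Suc j) / v (Suc j) - x j / v j) i"
    by (elim exE conjE) (rule that)
  note eq = eq0[rule_format]
  have "\<forall>M\<in>set Ms'. pos_lower_bidiagonal M \<or> pos_upper_bidiagonal M"
    "\<exists>M\<in>set Ms'. pos_lower_bidiagonal M" "\<exists>M\<in>set Ms'. pos_upper_bidiagonal M"
    using Ms' Suc.prems by blast+
  from Suc.IH[OF this] obtain S where S: "finite S" "card S = n"
    "\<And>m. m \<in> S \<Longrightarrow> mv_eigenvalue n (trunc_prod n Ms') m" by auto
  have step: "m \<noteq> 1 \<and> mv_eigenvalue (Suc n) A (r * m)" if "m \<in> S" for m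
  proof -
    obtain y i0 where i0: "i0 < n" "y i0 \<noteq> 0"
      and y: "\<And>i. i < n \<Longrightarrow> mv n (trunc_prod n Ms') y i = m * y i"
      using S(3)[OF \<open>m \<in> S\<close>] unfolding mv_eigenvalue_def by auto
    \<comment> \<open>Summation inverts the differencing: \<open>x\<close> is a preimage of
      \<open>y\<close>, unique up to multiples of \<open>v\<close>.\<close>
    define x where "x i = v i * (\<Sum>j<i. y j)" for i
    have diff: "x (Suc i) / v (Suc i) - x i / v i = y i" if "i < n" for i
      using v[of i] v[of "Suc i"] that by (simp add: x_def)
    \<comment> \<open>The defect of \<open>x\<close> from being an eigenvector for
      \<open>r * m\<close>, scaled by \<open>r * v\<close>. Its increments vanish by the equation
      for \<open>y\<close>, so it is constant.\<close>
    define g where "g i = mv (Suc n) A x i / (r * v i) - m * (x i / v i)" for i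
    have g: "g (Suc i) = g i" if "i < n" for i
    proof -
      have "mv n (trunc_prod n Ms') (\<lambda>j. x (Suc j) / v (Suc j) - x j / v j) i = m * y i"
        using y[OF that] mv_cong[of n "\<lambda>j. x (Suc j) / v (Suc j) - x j / v j" y "trunc_prod n Ms'"] diff
        by simp
      then show ?thesis
        using eq[OF that, of x] ev[of i] ev[of "Suc i"] that diff[OF that]
        unfolding g_def by (simp add: algebra_simps)
    qed
    have "g i = g 0" if "i < Suc n" for i using that by (induction i) (auto simp: g)
    then have x: "mv (Suc n) A x i = (r * m) * x i + (r * g 0) * v i" if "i < Suc n" for i
    proof -
      have rv: "v i \<noteq> 0" "r \<noteq> 0" using r v[OF that] by auto
      then have "mv (Suc n) A x i = (r * v i) * (mv (Suc n) A x i / (r * v i))" by simp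
      also have "mv (Suc n) A x i / (r * v i) = m * (x i / v i) + g 0"
        using \<open>\<And>i. i < Suc n \<Longrightarrow> g i = g 0\<close>[OF that] unfolding g_def[of i] by simp
      also have "(r * v i) * (m * (x i / v i) + g 0) = (r * m) * x i + (r * g 0) * v i"
        using rv by (simp add: algebra_simps)
      finally show ?thesis .
    qed
    \<comment> \<open>For \<open>m = 1\<close> the vector \<open>x\<close> would be a generalized
      eigenvector at the Perron value, hence a multiple of \<open>v\<close> with zero scaled
      increments, against \<open>y i0 \<noteq> 0\<close>.\<close>
    have "m \<noteq> 1"
    proof
      assume "m = 1"
      have "\<exists>k. \<forall>i<Suc n. x i = k * v i"
      proof (rule perron_generalized_simple[OF A])
        show "mv (Suc n) A x i = r * x i + (r * g 0) * v i" if "i < Suc n" for i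
          using x[OF that] \<open>m = 1\<close> by simp
      qed (use v ev in auto)
      then obtain k where "\<forall>i<Suc n. x i = k * v i" by blast
      then have "x (Suc i0) / v (Suc i0) - x i0 / v i0 = 0"
        using i0 v[of i0] v[of "Suc i0"] by simp
      then show False using diff[OF i0(1)] i0 by simp
    qed
    \<comment> \<open>Solves \<open>g 0 + t = m * t\<close>, so that adding \<open>t * v\<close> to
      \<open>x\<close> absorbs the defect.\<close>
    define t where "t = g 0 / (m - 1)"
    define z where "z i = 1 * x i + t * v i" for i
    have "mv (Suc n) A z i = r * m * z i" if "i < Suc n" for i
    proof -
      have "mv (Suc n) A z i = 1 * ((r * m) * x i + (r * g 0) * v i) + t * (r * v i)"
        unfolding z_def[abs_def] mv_combine using x[OF that] ev[OF that] by simp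
      also have "r * g 0 = t * r * m - t * r"
      proof -
        have g0: "g 0 = t * (m - 1)" using \<open>m \<noteq> 1\<close> by (simp add: t_def)
        show ?thesis unfolding g0 by (simp add: algebra_simps)
      qed
      finally show ?thesis by (simp add: z_def[of i] algebra_simps)
    qed
    \<comment> \<open>Adding a multiple of \<open>v\<close> does not change the scaled increment at
      \<open>i0\<close>, which is \<open>y i0\<close>.\<close>
    moreover have "z i0 \<noteq> 0 \<or> z (Suc i0) \<noteq> 0"
    proof (rule ccontr)
      assume "\<not> ?thesis"
      then have "x i0 = - t * v i0" "x (Suc i0) = - t * v (Suc i0)"
        by (simp_all add: z_def eq_neg_iff_add_eq_0)
      then show False using diff[OF i0(1)] i0 v[of i0] v[of "Suc i0"] by simp
    qed
    moreover from this have "\<exists>i<Suc n. z i \<noteq> 0" using i0(1) by (metis Suc_mono less_SucI)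
    ultimately have "mv_eigenvalue (Suc n) A (r * m)" unfolding mv_eigenvalue_def by blast
    with \<open>m \<noteq> 1\<close> show ?thesis by simp
  qed
  have "v 0 \<noteq> 0" using v[of 0] by simp
  then have "mv_eigenvalue (Suc n) A r" unfolding mv_eigenvalue_def using ev by blast
  moreover have "r \<notin> (*) r ` S" using step r by auto
  moreover have "card ((*) r ` S) = n" using S r by (subst card_image) (auto simp: inj_on_def)
  ultimately show ?case
    using S step by (intro exI[of _ "insert r ((*) r ` S)"]) (auto simp: A_def)
qed

section \<open>Truncating the infinite factorization\<close>

lemma smat_mult_finite:
  assumes "\<And>k. n \<le> k \<Longrightarrow> A i k * B k j = 0"
  shows "smat_mult A B i j = (\<Sum>k<n. A i k * B k j)"
  unfolding smat_mult_def by (rule suminf_finite) (use assms in \<open>auto simp: not_less\<close>)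

text \<open>Triangularity is proved along with the truncation because it removes the terms with k >=
  n from the series when j < n.\<close>

lemma upper_prod_truncation:
  assumes "\<forall>U\<in>set Us. pos_upper_bidiagonal U"
  shows "(j < i \<longrightarrow> foldr smat_mult Us smat_one i j = 0) \<and>
    (i < n \<longrightarrow> j < n \<longrightarrow> foldr smat_mult Us smat_one i j = trunc_prod n Us i j)"
  using assms
proof (induction Us arbitrary: i)
  case Nil
  then show ?case by (simp add: smat_one_def trunc_prod_def)
next
  case (Cons U Us)
  let ?B = "foldr smat_mult Us smat_one"
  have U: "pos_upper_bidiagonal U" using Cons.prems by simp
  have B: "j < k \<Longrightarrow> ?B k j = 0" "k < n \<Longrightarrow> j < n \<Longrightarrow> ?B k j = trunc_prod n Us k j" for k
    using Cons.IH[of k] Cons.prems by auto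
  show ?case
  proof (intro conjI impI)
    assume "j < i"
    \<comment> \<open>Every term of the series vanishes, so the cut-off may be taken to be
      0.\<close>
    have "smat_mult U ?B i j = (\<Sum>k<0. U i k * ?B k j)"
    proof (rule smat_mult_finite)
      fix k show "U i k * ?B k j = 0"
      proof (cases "U i k = 0")
        case False
        then have "j < k" using pos_upper_bidiagonalD(3)[OF U False] \<open>j < i\<close> by auto
        then show ?thesis by (simp add: B(1))
      qed simp
    qed
    then show "foldr smat_mult (U # Us) smat_one i j = 0" by simp
  next
    assume ij: "i < n" "j < n"
    have "smat_mult U ?B i j = (\<Sum>k<n. U i k * ?B k j)"
      by (rule smat_mult_finite) (use B(1) ij in auto)
    also have "\<dots> = (\<Sum>k<n. U i k * trunc_prod n Us k j)"
      using B(2) ij by simp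
    finally show "foldr smat_mult (U # Us) smat_one i j = trunc_prod n (U # Us) i j"
      by (simp add: trunc_prod_def)
  qed
qed

text \<open>Depends on the order of the factors: for i < n a lower factor on the left has no entry
  in a column k >= n, so nothing outside the block is ever reached.\<close>

lemma factorization_truncation:
  assumes "\<forall>L\<in>set Ls. pos_lower_bidiagonal L" "\<forall>U\<in>set Us. pos_upper_bidiagonal U" "i < n" "j < n"
  shows "foldr smat_mult (Ls @ Us) smat_one i j = trunc_prod n (Ls @ Us) i j"
  using assms(1,3)
proof (induction Ls arbitrary: i)
  case Nil
  then show ?case using upper_prod_truncation[OF assms(2)] assms(4) by simp
next
  case (Cons L Ls)
  have L: "pos_lower_bidiagonal L" using Cons.prems by simp
  let ?B = "foldr smat_mult (Ls @ Us) smat_one"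
  have "smat_mult L ?B i j = (\<Sum>k<n. L i k * ?B k j)"
    by (rule smat_mult_finite) (use pos_lower_bidiagonalD(4)[OF L, of i] Cons.prems in force)
  also have "\<dots> = (\<Sum>k<n. L i k * trunc_prod n (Ls @ Us) k j)"
    using Cons by simp
  finally show ?case by (simp add: trunc_prod_def)
qed

text \<open>A matrix of size \<open>n\<close> has at most \<open>n\<close> eigenvalues, so the
  \<open>n\<close> distinct ones found by deflation exhaust the spectrum.\<close>

lemma spectrum_leading_block:
  assumes "positive_bidiagonal_factorization p q T" "1 \<le> p" "1 \<le> q"
  shows "finite (spectrum (leading_block T n))" "card (spectrum (leading_block T n)) = n"
proof -
  obtain Ls Us where len: "length Ls = p" "length Us = q"
    and L: "\<forall>L\<in>set Ls. pos_lower_bidiagonal L" and U: "\<forall>U\<in>set Us. pos_upper_bidiagonal U"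
    and T: "T = foldr smat_mult (Ls @ Us) smat_one"
    using assms(1) unfolding positive_bidiagonal_factorization_def by blast
  have "Ls \<noteq> []" "Us \<noteq> []" using len assms(2,3) by auto
  then have ne: "hd Ls \<in> set Ls" "hd Us \<in> set Us" by auto
  have carr: "leading_block T n \<in> carrier_mat n n" by (simp add: leading_block_def)
  show "finite (spectrum (leading_block T n))" by (rule card_finite_spectrum(1)[OF carr])
  have "\<forall>M\<in>set (Ls @ Us). pos_lower_bidiagonal M \<or> pos_upper_bidiagonal M"
    "\<exists>M\<in>set (Ls @ Us). pos_lower_bidiagonal M" "\<exists>M\<in>set (Ls @ Us). pos_upper_bidiagonal M"
    using L U ne by (auto intro: bexI[of _ "hd Ls"] bexI[of _ "hd Us"])
  from trunc_prod_eigenvalues[OF this, of n]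
  obtain S where S: "finite S" "card S = n" "\<And>r. r \<in> S \<Longrightarrow> mv_eigenvalue n (trunc_prod n (Ls @ Us)) r"
    by blast
  have "S \<subseteq> spectrum (leading_block T n)"
  proof
    fix r assume "r \<in> S"
    then obtain x i0 where i0: "i0 < n" "x i0 \<noteq> 0"
      and x: "\<And>i. i < n \<Longrightarrow> mv n (trunc_prod n (Ls @ Us)) x i = r * x i"
      using S(3) unfolding mv_eigenvalue_def by blast
    have Tx: "(\<Sum>l<n. T i l * x l) = r * x i" if "i < n" for i
      using x[OF that] factorization_truncation[OF L U that] unfolding mv_def T by simp
    have "leading_block T n *\<^sub>v Matrix.vec n x = r \<cdot>\<^sub>v Matrix.vec n x"
      by (rule eq_vecI) (auto simp: leading_block_def scalar_prod_def atLeast0LessThan Tx)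
    moreover have "Matrix.vec n x \<noteq> 0\<^sub>v n"
      using i0 by (metis index_vec index_zero_vec(1))
    ultimately have "eigenvector (leading_block T n) (Matrix.vec n x) r"
      unfolding eigenvector_def by (simp add: leading_block_def)
    then show "r \<in> spectrum (leading_block T n)"
      unfolding spectrum_def eigenvalue_def by blast
  qed
  then have "n \<le> card (spectrum (leading_block T n))"
    using S card_mono[OF card_finite_spectrum(1)[OF carr]] by metis
  then show "card (spectrum (leading_block T n)) = n"
    using card_finite_spectrum(2)[OF carr] by simp
qed

section \<open>Recurrence and the Green function\<close>

primrec smat_power :: "nat \<Rightarrow> smat \<Rightarrow> nat \<Rightarrow> smat" where
  "smat_power q T 0 = smat_one"
| "smat_power q T (Suc k) = (\<lambda>i j. \<Sum>l\<le>i + q. T i l * smat_power q T k l j)"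

locale banded_chain =
  fixes q :: nat and T :: smat
  assumes stochastic: "stochastic T" and band: "\<And>i j. i + q < j \<Longrightarrow> T i j = 0"
begin

abbreviation "pw \<equiv> smat_power q T"

lemma T_nonneg: "0 \<le> T i j"
  using stochastic by (simp add: stochastic_def)

lemma row_sum: "(\<Sum>l\<le>i + q. T i l) = 1"
proof -
  have "T i sums (\<Sum>l\<le>i + q. T i l)" by (rule sums_finite) (auto simp: band)
  then show ?thesis using stochastic by (metis stochastic_def sums_unique2)
qed

lemma pw_nonneg: "0 \<le> pw k i j"
  by (induction k arbitrary: i) (auto simp: smat_one_def T_nonneg intro!: sum_nonneg)

lemma pw_le_1: "pw k i j \<le> 1"
proof (induction k arbitrary: i)
  case (Suc k)
  have "pw (Suc k) i j \<le> (\<Sum>l\<le>i + q. T i l * 1)"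
    unfolding smat_power.simps using Suc T_nonneg by (intro sum_mono mult_left_mono)
  then show ?case by (simp add: row_sum)
qed (simp add: smat_one_def)

lemma pw_add_ge: "pw m i l * pw n l j \<le> pw (m + n) i j"
proof (induction m arbitrary: i)
  case 0
  then show ?case by (simp add: smat_one_def pw_nonneg)
next
  case (Suc m)
  have "pw (Suc m) i l * pw n l j = (\<Sum>k\<le>i + q. T i k * (pw m k l * pw n l j))"
    by (simp add: sum_distrib_right mult.assoc)
  also have "\<dots> \<le> pw (Suc m + n) i j"
    using Suc T_nonneg by (auto intro!: sum_mono mult_left_mono)
  finally show ?case .
qed

lemma pw_1: "pw 1 i j = T i j"
proof -
  have "pw 1 i j = (\<Sum>l\<le>i + q. if l = j then T i l else 0)"
    by (simp add: smat_one_def if_distrib cong: if_cong)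
  then show ?thesis using band[of i j] by (cases "i + q < j") auto
qed

text \<open>First passage from an arbitrary start \<open>j\<close>, since conditioning on the first
  step moves the start; for \<open>j = i\<close> it is \<open>first_return_prob\<close>.\<close>

definition hit :: "nat \<Rightarrow> nat \<Rightarrow> nat \<Rightarrow> real" where
  "hit i r j = measure_pmf.prob (trajectory_pmf T r j) {X. X ! r = i \<and> (\<forall>t\<in>{1..<r}. X ! t \<noteq> i)}"

lemma trajectory_start: "X \<in> set_pmf (trajectory_pmf T r j) \<Longrightarrow> X ! 0 = j"
  by (cases r) auto

text \<open>First-step analysis. After the step, time 1 becomes time 0 of the remaining path: for r
  > 0 its start must avoid \<open>i\<close>, for r = 0 it must be \<open>i\<close>.\<close>

lemma hit_Suc:
  "hit i (Suc r) j = (\<Sum>k\<le>j + q. T j k * (if r = 0 then (if k = i then 1 else 0)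
      else (if k = i then 0 else hit i r k)))"
proof -
  let ?E = "{X. X ! Suc r = i \<and> (\<forall>t\<in>{1..<Suc r}. X ! t \<noteq> i)}"
  let ?F = "{X. X ! r = i \<and> (\<forall>t\<in>{0..<r}. X ! t \<noteq> i)}"
  let ?c = "\<lambda>k. if r = 0 then (if k = i then 1 else 0) else (if k = i then 0 else hit i r k)"
  have vim: "(#) j -` ?E = ?F"
  proof -
    have "(\<forall>t\<in>{1..<Suc r}. (j # X) ! t \<noteq> i) \<longleftrightarrow> (\<forall>t\<in>{0..<r}. X ! t \<noteq> i)" for X
    proof -
      have "{1..<Suc r} = Suc ` {0..<r}" by (simp add: image_Suc_atLeastLessThan)
      then show ?thesis by (simp del: image_Suc_atLeastLessThan One_nat_def)
    qed
    then show ?thesis by auto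
  qed
  have F: "measure_pmf.prob (trajectory_pmf T r k) ?F = ?c k" for k
  proof (cases "r = 0")
    case True
    then show ?thesis by (simp add: measure_return_pmf indicator_def)
  next
    case False
    have split: "(\<forall>t\<in>{0..<r}. X ! t \<noteq> i) \<longleftrightarrow> X ! 0 \<noteq> i \<and> (\<forall>t\<in>{1..<r}. X ! t \<noteq> i)" for X :: "nat list"
      using False by (auto simp: Suc_le_eq)
    have "measure_pmf.prob (trajectory_pmf T r k) ?F =
        measure_pmf.prob (trajectory_pmf T r k)
          (if k = i then {} else {X. X ! r = i \<and> (\<forall>t\<in>{1..<r}. X ! t \<noteq> i)})"
      by (rule measure_pmf.finite_measure_eq_AE)
         (auto simp: AE_measure_pmf_iff split dest!: trajectory_start)
    then show ?thesis using False by (simp add: hit_def)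
  qed
  have "hit i (Suc r) j =
      (\<integral>k. measure_pmf.prob (map_pmf ((#) j) (trajectory_pmf T r k)) ?E \<partial>measure_pmf (step_pmf T j))"
    unfolding hit_def trajectory_pmf.simps measure_pmf_bind
    by (rule measure_pmf.measure_bind[where N = "count_space UNIV"])
       (simp_all add: measure_pmf_in_subprob_algebra)
  also have "\<dots> = (\<integral>k. ?c k \<partial>measure_pmf (step_pmf T j))"
    by (simp only: measure_map_pmf vim F)
  also have "\<dots> = (\<Sum>k\<in>{..j + q}. ?c k * pmf (step_pmf T j) k)"
  proof (rule integral_measure_pmf_real)
    fix k assume "k \<in> set_pmf (step_pmf T j)"
    then have "T j k \<noteq> 0" by (simp add: set_pmf_iff pmf_step_pmf[OF stochastic])
    then show "k \<in> {..j + q}" using band[of j k] by (metis atMost_iff not_le)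
  qed simp
  finally show ?thesis by (simp add: pmf_step_pmf[OF stochastic] mult.commute)
qed

lemma hit_Suc_Suc:
  "hit i (Suc (Suc r)) j = (\<Sum>k\<le>j + q. T j k * (if k = i then 0 else hit i (Suc r) k))"
  by (subst hit_Suc) simp

lemma hit_1: "hit i 1 j = T j i"
proof -
  have "hit i 1 j = (\<Sum>k\<le>j + q. if k = i then T j k else 0)"
    by (simp add: hit_Suc if_distrib cong: if_cong)
  then show ?thesis using band[of j i] by (cases "j + q < i") auto
qed

text \<open>Induction through the first step: it either lands in \<open>i\<close>, which gives the
  term r = 0, or lands elsewhere, where the induction hypothesis applies with a new start.\<close>

lemma pw_renewal: "pw (Suc n) j i = (\<Sum>r\<le>n. hit i (Suc r) j * pw (n - r) i i)"
proof (induction n arbitrary: j)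
  case 0
  then show ?case using hit_1 pw_1 by (simp add: smat_one_def)
next
  case (Suc n)
  let ?g = "\<lambda>k. \<Sum>r\<le>n. hit i (Suc r) k * pw (n - r) i i"
  have "pw (Suc (Suc n)) j i = (\<Sum>k\<le>j + q. T j k * pw (Suc n) k i)" by (simp only: smat_power.simps)
  also have "\<dots> = (\<Sum>k\<le>j + q. (if k = i then T j k * pw (Suc n) i i else 0)
      + T j k * (if k = i then 0 else ?g k))"
    by (intro sum.cong refl) (simp add: Suc del: smat_power.simps)
  also have "\<dots> = (\<Sum>k\<le>j + q. if k = i then T j k * pw (Suc n) i i else 0)
      + (\<Sum>k\<le>j + q. T j k * (if k = i then 0 else ?g k))"
    by (rule sum.distrib)
  also have "(\<Sum>k\<le>j + q. if k = i then T j k * pw (Suc n) i i else 0) = hit i 1 j * pw (Suc n) i i"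
    unfolding hit_1 using band[of j i] by (cases "j + q < i") auto
  also have "(\<Sum>k\<le>j + q. T j k * (if k = i then 0 else ?g k)) =
      (\<Sum>k\<le>j + q. \<Sum>r\<le>n. T j k * (if k = i then 0 else hit i (Suc r) k) * pw (n - r) i i)"
    by (intro sum.cong refl) (simp add: sum_distrib_left mult.assoc)
  also have "\<dots> = (\<Sum>r\<le>n. \<Sum>k\<le>j + q. T j k * (if k = i then 0 else hit i (Suc r) k) * pw (n - r) i i)"
    by (rule sum.swap)
  also have "\<dots> = (\<Sum>r\<le>n. hit i (Suc (Suc r)) j * pw (n - r) i i)"
    by (simp only: hit_Suc_Suc sum_distrib_right)
  finally show ?case
    by (subst sum.atMost_Suc_shift) (simp del: smat_power.simps sum.atMost_Suc)
qed

end

text \<open>The renewal equation turns into F G = G - 1, that is F = 1 - 1/G, for the generating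
  functions. Hence F tends to 1 iff G tends to infinity, and for nonnegative coefficients this is
  divergence of the series of \<open>P\<close>.\<close>

lemma power_series_renewal:
  fixes f P :: "nat \<Rightarrow> real"
  assumes f: "\<And>n. 0 \<le> f n" "\<And>n. f n \<le> 1" and P: "\<And>n. 0 \<le> P n" "\<And>n. P n \<le> 1"
    and "P 0 = 1" "f 0 = 0" and renewal: "\<And>n. P (Suc n) = (\<Sum>i\<le>Suc n. f i * P (Suc n - i))"
  shows "((\<lambda>s. \<Sum>n. f n * s ^ n) \<longlongrightarrow> 1) (at_left 1) \<longleftrightarrow> \<not> summable P"
proof -
  define F where "F s = (\<Sum>n. f n * s ^ n)" for s :: real
  define G where "G s = (\<Sum>n. P n * s ^ n)" for s :: real
  have summ: "summable (\<lambda>n. a n * s ^ n)"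
    if "\<And>n. 0 \<le> a n" "\<And>n. a n \<le> 1" "0 \<le> s" "s < 1" for a :: "nat \<Rightarrow> real" and s
    by (rule summable_comparison_test[OF _ summable_geometric[of s]])
       (use that in \<open>auto intro!: mult_left_le_one_le\<close>)
  have FG: "F s = 1 - 1 / G s" and G1: "1 \<le> G s" if s: "0 \<le> s" "s < 1" for s
  proof -
    note sf = summ[of f s, OF f s] and sP = summ[of P s, OF P s]
    have conv: "(\<Sum>i\<le>n. (f i * s ^ i) * (P (n - i) * s ^ (n - i))) = P n * s ^ n - (if n = 0 then 1 else 0)"
      for n
    proof -
      have "(\<Sum>i\<le>n. (f i * s ^ i) * (P (n - i) * s ^ (n - i))) = (\<Sum>i\<le>n. f i * P (n - i) * s ^ n)"
      proof (intro sum.cong refl)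
        fix i assume "i \<in> {..n}"
        then have "s ^ n = s ^ i * s ^ (n - i)" by (simp add: power_add[symmetric])
        then show "(f i * s ^ i) * (P (n - i) * s ^ (n - i)) = f i * P (n - i) * s ^ n" by simp
      qed
      also have "\<dots> = (\<Sum>i\<le>n. f i * P (n - i)) * s ^ n" by (simp add: sum_distrib_right)
      finally show ?thesis using \<open>P 0 = 1\<close> \<open>f 0 = 0\<close> renewal by (cases n) auto
    qed
    have "F s * G s = (\<Sum>n. P n * s ^ n - (if n = 0 then 1 else 0))"
      unfolding F_def G_def conv[symmetric]
      by (rule Cauchy_product) (use sf sP f P s in \<open>simp_all add: abs_mult\<close>)
    also have "\<dots> = G s - (\<Sum>n. if n = 0 then 1 else (0::real))"
      unfolding G_def by (rule suminf_diff[symmetric, OF sP]) (auto intro: summable_If_finite)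
    also have "(\<Sum>n. if n = 0 then 1 else (0::real)) = 1"
      using suminf_finite[of "{0::nat}" "\<lambda>n. if n = 0 then 1 else (0::real)"] by simp
    finally have eq: "F s * G s = G s - 1" .
    have "(\<Sum>n<1. P n * s ^ n) \<le> G s"
      unfolding G_def by (rule sum_le_suminf[OF sP]) (use P s in auto)
    then show "1 \<le> G s" using \<open>P 0 = 1\<close> by simp
    then show "F s = 1 - 1 / G s" using eq by (simp add: field_simps)
  qed
  have near: "eventually (\<lambda>s. 0 \<le> s \<and> s < 1) (at_left (1::real))"
    using eventually_at_left_real[of 0 1] by (rule eventually_mono) auto
  have "(F \<longlongrightarrow> 1) (at_left 1) \<longleftrightarrow> \<not> summable P"
  proof
    assume lim: "(F \<longlongrightarrow> 1) (at_left 1)"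
    show "\<not> summable P"
    proof
      assume sP: "summable P"
      have "F s \<le> 1 - 1 / suminf P" if s: "0 \<le> s" "s < 1" for s
      proof -
        have "G s \<le> suminf P"
          unfolding G_def
          by (rule suminf_le[OF _ summ[of P s, OF P s] sP])
             (use P s in \<open>auto intro!: mult_right_le_one_le power_le_one\<close>)
        then show ?thesis using FG[OF s] G1[OF s] by (simp add: frac_le)
      qed
      then have "1 \<le> 1 - 1 / suminf P"
        by (intro tendsto_upperbound[OF lim]) (auto intro: eventually_mono[OF near])
      moreover have "0 < suminf P"
        using sum_le_suminf[OF sP, of "{..<1}"] P \<open>P 0 = 1\<close> by force
      ultimately show False by (simp add: divide_le_0_iff)
    qed
  next
    assume nP: "\<not> summable P"
    have "filterlim G at_top (at_left 1)"
      unfolding filterlim_at_top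
    proof
      fix Z :: real
      have "\<exists>n. Z < (\<Sum>k<n. P k)"
      proof (rule ccontr)
        assume "\<not> ?thesis"
        then have "summable P" using P by (intro summableI_nonneg_bounded[of P Z]) (auto simp: not_less)
        with nP show False by simp
      qed
      then obtain n where n: "Z < (\<Sum>k<n. P k)" by auto
      \<comment> \<open>A partial sum is continuous at 1 and a lower bound for \<open>G\<close>, so
        a large partial sum at 1 makes \<open>G\<close> large nearby.\<close>
      have "((\<lambda>s. \<Sum>k<n. P k * s ^ k) \<longlongrightarrow> (\<Sum>k<n. P k * 1 ^ k)) (at_left 1)"
        by (intro tendsto_intros)
      then have "eventually (\<lambda>s. Z < (\<Sum>k<n. P k * s ^ k)) (at_left 1)"
        using n by (intro order_tendstoD(1)) auto
      then show "eventually (\<lambda>s. Z \<le> G s) (at_left 1)"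
        using near
      proof eventually_elim
        case (elim s)
        have "(\<Sum>k<n. P k * s ^ k) \<le> G s"
          unfolding G_def by (rule sum_le_suminf[OF summ[of P s, OF P]]) (use P elim in auto)
        then show ?case using elim by simp
      qed
    qed
    then have "((\<lambda>s. 1 - 1 / G s) \<longlongrightarrow> 1 - 0) (at_left 1)"
      by (intro tendsto_intros tendsto_divide_0[OF tendsto_const] filterlim_at_top_imp_at_infinity)
    moreover have "eventually (\<lambda>s. 1 - 1 / G s = F s) (at_left 1)"
      using near by (rule eventually_mono) (simp add: FG)
    ultimately show "(F \<longlongrightarrow> 1) (at_left 1)" by (simp add: tendsto_cong)
  qed
  then show ?thesis by (simp add: F_def[abs_def])
qed

context banded_chain
begin

lemma recurrent_state_iff: "recurrent_state T i \<longleftrightarrow> \<not> summable (\<lambda>k. pw k i i)"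
proof -
  \<comment> \<open>The value 0 at time 0 aligns the index with \<open>first_return_gf\<close>,
    whose series starts at time 1.\<close>
  define f where "f r = (case r of 0 \<Rightarrow> 0 | Suc r \<Rightarrow> hit i (Suc r) i)" for r
  have f: "0 \<le> f r" "f r \<le> 1" for r
    by (auto simp: f_def hit_def split: nat.split)
  have eq: "first_return_gf T i s = (\<Sum>n. f n * s ^ n)" if "0 \<le> s" "s < 1" for s
  proof -
    have "summable (\<lambda>n. f n * s ^ n)"
      by (rule summable_comparison_test[OF _ summable_geometric[of s]])
         (use f that in \<open>auto intro!: mult_left_le_one_le\<close>)
    from suminf_split_head[OF this] show ?thesis
      by (simp add: first_return_gf_def first_return_prob_def f_def hit_def)
  qed
  have "((\<lambda>s. \<Sum>n. f n * s ^ n) \<longlongrightarrow> 1) (at_left 1) \<longleftrightarrow> \<not> summable (\<lambda>k. pw k i i)"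
  proof (rule power_series_renewal)
    show "pw (Suc n) i i = (\<Sum>r\<le>Suc n. f r * pw (Suc n - r) i i)" for n
      unfolding pw_renewal by (subst sum.atMost_Suc_shift) (simp add: f_def)
    show "f 0 = 0" by (simp add: f_def)
  qed (simp_all add: f pw_nonneg pw_le_1 smat_one_def del: smat_power.simps(2))
  moreover have "eventually (\<lambda>s. first_return_gf T i s = (\<Sum>n. f n * s ^ n)) (at_left 1)"
    using eventually_at_left_real[of 0 1] by (rule eventually_mono) (auto simp: eq)
  ultimately show ?thesis
    unfolding recurrent_state_def by (simp add: tendsto_cong)
qed

text \<open>Going from i down to 0, making a loop of length k there and climbing back embeds loops
  at 0 into loops at i of length k + 2 i. So summability at any i implies it at 0.\<close>

lemma recurrent_chain_iff:
  assumes up: "\<And>i. 0 < T i (Suc i)" and down: "\<And>i. 0 < T (Suc i) i"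
  shows "recurrent_chain T \<longleftrightarrow> \<not> summable (\<lambda>k. pw k 0 0)"
proof -
  have pos: "0 < pw i 0 i \<and> 0 < pw i i 0" for i
  proof (induction i)
    case (Suc i)
    have "0 < pw i 0 i * pw 1 i (Suc i)" "0 < pw 1 (Suc i) i * pw i i 0"
      using Suc up[of i] down[of i] by (simp_all only: pw_1 mult_pos_pos)
    then show ?case
      using pw_add_ge[of i 0 i 1 "Suc i"] pw_add_ge[of 1 "Suc i" i i 0] by (simp del: smat_power.simps)
  qed (simp add: smat_one_def)
  have "summable (\<lambda>k. pw k 0 0)" if s: "summable (\<lambda>k. pw k i i)" for i
  proof (rule summable_comparison_test)
    show "summable (\<lambda>k. pw (k + (i + i)) i i / (pw i i 0 * pw i 0 i))"
      by (intro summable_divide summable_ignore_initial_segment s)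
    have "pw k 0 0 \<le> pw (k + (i + i)) i i / (pw i i 0 * pw i 0 i)" for k
    proof -
      have "(pw i i 0 * pw k 0 0) * pw i 0 i \<le> pw (i + k) i 0 * pw i 0 i"
        by (intro mult_right_mono pw_add_ge pw_nonneg)
      also have "\<dots> \<le> pw (i + k + i) i i" by (rule pw_add_ge)
      also have "i + k + i = k + (i + i)" by simp
      finally show ?thesis using pos[of i] by (simp add: field_simps)
    qed
    then show "\<exists>N. \<forall>k\<ge>N. norm (pw k 0 0) \<le> pw (k + (i + i)) i i / (pw i i 0 * pw i 0 i)"
      by (simp add: pw_nonneg)
  qed
  then show ?thesis unfolding recurrent_chain_def recurrent_state_iff by blast
qed

end

text \<open>Geometric series and monotone convergence. At x = 1 both sides of the expansion are
  infinite, so an atom at 1 is counted correctly.\<close>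

lemma recurrence_integral_infinite_iff:
  assumes "finite_borel_measure M" and supp: "AE x in M. x \<in> {0..1}"
    and mom: "\<And>k. (\<integral>x. x ^ k \<partial>M) = m k"
  shows "recurrence_integral M = \<infinity> \<longleftrightarrow> \<not> summable m"
proof -
  interpret finite_borel_measure M by fact
  have [measurable_cong]: "sets M = sets borel" by (rule M_is_borel)
  have int: "integrable M (\<lambda>x. x ^ k)" for k
  proof (rule integrable_const_bound[where B = 1])
    show "AE x in M. norm (x ^ k) \<le> 1"
      using supp by (rule AE_mp) (auto intro!: AE_I2 simp: power_le_one)
  qed simp
  have mom': "(\<integral>\<^sup>+x. ennreal (x ^ k) \<partial>M) = ennreal (m k)" for k
    unfolding mom[symmetric]
    by (rule nn_integral_eq_integral[OF int]) (use supp in \<open>auto elim!: eventually_mono\<close>)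
  have m0: "0 \<le> m k" for k
    unfolding mom[symmetric] by (rule integral_nonneg_AE) (use supp in \<open>auto elim!: eventually_mono\<close>)
  have geo: "1 / ennreal (1 - x) = (\<Sum>k. ennreal (x ^ k))" if "0 \<le> x" "x \<le> 1" for x
  proof (cases "x = 1")
    case True
    have "(\<Sum>k. ennreal (x ^ k)) = \<infinity>"
    proof (rule ccontr)
      assume "\<not> ?thesis"
      then have "summable (\<lambda>k. x ^ k)" using that by (intro summable_suminf_not_top) auto
      then show False using True by (auto dest: summable_LIMSEQ_zero simp: LIMSEQ_const_iff)
    qed
    moreover have "1 / (0 :: ennreal) = \<infinity>" by (simp add: divide_ennreal_def)
    ultimately show ?thesis using True by simp
  next
    case False
    then have "(\<Sum>k. ennreal (x ^ k)) = ennreal (\<Sum>k. x ^ k)"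
      using that by (intro suminf_ennreal2) auto
    also have "(\<Sum>k. x ^ k) = 1 / (1 - x)" using that False by (intro suminf_geometric) auto
    also have "ennreal (1 / (1 - x)) = 1 / ennreal (1 - x)"
      using that False by (simp add: divide_ennreal[symmetric])
    finally show ?thesis by simp
  qed
  have "recurrence_integral M = (\<integral>\<^sup>+x. (\<Sum>k. ennreal (x ^ k)) \<partial>M)"
    unfolding recurrence_integral_def
  proof (rule nn_integral_cong_AE)
    show "AE x in M. 1 / ennreal (1 - x) * indicator {0..1} x = (\<Sum>k. ennreal (x ^ k))"
      using supp by (rule eventually_mono) (simp add: geo)
  qed
  also have "\<dots> = (\<Sum>k. ennreal (m k))"
    by (subst nn_integral_suminf) (auto simp: mom')
  finally have "recurrence_integral M = (\<Sum>k. ennreal (m k))" .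
  moreover have "summable m" if "(\<Sum>k. ennreal (m k)) \<noteq> \<infinity>"
    using that m0 by (intro summable_suminf_not_top) auto
  moreover have "(\<Sum>k. ennreal (m k)) \<noteq> \<infinity>" if "summable m"
    unfolding suminf_ennreal2[OF m0 that] by simp
  ultimately show ?thesis by metis
qed

section \<open>Weak convergence and moments\<close>

text \<open>Two gaps to bridge: powers are unbounded on the line, and the convergence theorem for
  integrals wants a probability measure as limit. The first is met by clamping to [-1,1], the second
  by evaluating distribution functions to the right of the support.\<close>

lemma weak_conv_moments:
  assumes \<mu>: "\<And>n. real_distribution (\<mu> n)" "\<And>n. AE x in \<mu> n. x \<in> {- 1..1}"
    and M: "finite_borel_measure M" "AE x in M. x \<in> {- 1..1}" and conv: "weak_conv_m \<mu> M"
  shows "(\<lambda>n. \<integral>x. x ^ k \<partial>\<mu> n) \<longlonglongrightarrow> (\<integral>x. x ^ k \<partial>M)"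
proof -
  interpret M: finite_borel_measure M by fact
  have sM [measurable_cong]: "sets M = sets borel" by (rule M.M_is_borel)
  have s\<mu> [measurable_cong]: "sets (\<mu> n) = sets borel" for n
    by (rule real_distribution.events_eq_borel[OF \<mu>(1)])
  have cdf2: "cdf N 2 = measure N (space N)"
    if "sets N = sets borel" "AE y in N. y \<in> {- 1..1}" "finite_measure N" for N :: "real measure"
    unfolding cdf_def
  proof (rule finite_measure.finite_measure_eq_AE[OF that(3)])
    show "AE x in N. (x \<in> {..2}) = (x \<in> space N)"
      using that(2) sets_eq_imp_space_eq[OF that(1)] by (auto elim: eventually_mono)
  qed (use that(1) in auto)
  \<comment> \<open>The point 2 carries no mass, so it is a continuity point; there each
    distribution function already equals the total mass.\<close>
  have "measure M {2} = measure M {}"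
    by (rule M.finite_measure_eq_AE) (use M(2) sM in \<open>auto elim: eventually_mono\<close>)
  then have "isCont (cdf M) 2" by (simp add: M.isCont_cdf)
  then have "(\<lambda>n. cdf (\<mu> n) 2) \<longlonglongrightarrow> cdf M 2"
    using conv by (simp add: weak_conv_m_def weak_conv_def)
  moreover have "cdf (\<mu> n) 2 = 1" for n
    using cdf2[OF s\<mu> \<mu>(2)] \<mu>(1)[of n]
    by (simp add: real_distribution_def prob_space.prob_space prob_space.finite_measure)
  ultimately have "cdf M 2 = 1" by (simp add: LIMSEQ_const_iff)
  then have "prob_space M"
    using cdf2[OF sM M(2) M.finite_measure_axioms]
    by (intro prob_spaceI) (simp add: M.emeasure_eq_measure)
  then have "real_distribution M" using sM by (simp add: real_distribution_def real_distribution_axioms_def)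
  define f where "f x = (max (- 1) (min 1 x)) ^ k" for x :: real
  have "(\<lambda>n. integral\<^sup>L (\<mu> n) f) \<longlonglongrightarrow> integral\<^sup>L M f"
  proof (rule weak_conv_imp_integral_bdd_continuous_conv[OF \<mu>(1) \<open>real_distribution M\<close> conv])
    show "isCont f x" for x unfolding f_def[abs_def] by (intro continuous_intros)
    show "norm (f x) \<le> 1" for x
      unfolding f_def norm_power by (intro power_le_one) auto
  qed
  moreover have "integral\<^sup>L N f = (\<integral>x. x ^ k \<partial>N)"
    if [measurable_cong]: "sets N = sets borel" and "AE y in N. y \<in> {- 1..1}" for N
    unfolding f_def[abs_def]
  proof (rule integral_cong_AE)
    show "AE x in N. (max (- 1) (min 1 x)) ^ k = x ^ k"
      using that(2) by (rule eventually_mono) simp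
  qed simp_all
  ultimately show ?thesis using s\<mu> sM \<mu> M by simp
qed

lemma distr_point_measure_moments:
  fixes g :: "nat \<Rightarrow> real" and c :: "nat \<Rightarrow> real"
  assumes c: "\<And>k. k \<le> N \<Longrightarrow> 0 \<le> c k" and sum1: "(\<Sum>k\<le>N. c k) = 1" and g: "\<And>k. k \<le> N \<Longrightarrow> g k \<in> S"
    and S: "S \<in> sets borel"
  defines "D \<equiv> distr (point_measure {..N} (\<lambda>k. ennreal (c k))) borel g"
  shows "real_distribution D" "AE x in D. x \<in> S" "(\<integral>x. x ^ m \<partial>D) = (\<Sum>k\<le>N. c k * g k ^ m)"
proof -
  let ?P = "point_measure {..N} (\<lambda>k. ennreal (c k))"
  have meas [measurable]: "g \<in> ?P \<rightarrow>\<^sub>M borel" by simp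
  have "emeasure ?P (space ?P) = ennreal (\<Sum>k\<le>N. c k)"
    using c by (subst emeasure_point_measure_finite) (auto simp: space_point_measure intro!: sum_ennreal)
  then have "prob_space ?P" using sum1 by (intro prob_spaceI) simp
  then have "prob_space D" unfolding D_def by (rule prob_space.prob_space_distr) simp
  then show "real_distribution D" by (simp add: real_distribution_def real_distribution_axioms_def D_def)
  show "AE x in D. x \<in> S"
    unfolding D_def using S g by (subst AE_distr_iff) (auto simp: space_point_measure intro!: AE_I2)
  show "(\<integral>x. x ^ m \<partial>D) = (\<Sum>k\<le>N. c k * g k ^ m)"
    
  proof -
    have "(\<integral>x. x ^ m \<partial>D) = (\<integral>k. g k ^ m \<partial>?P)"
      unfolding D_def by (rule integral_distr) simp_all
    also have "\<dots> = (\<Sum>k\<le>N. c k *\<^sub>R g k ^ m)"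
      using c by (intro lebesgue_integral_point_measure_finite) auto
    finally show ?thesis by simp
  qed
qed

section \<open>Recursion polynomials and eigenvectors\<close>

lemma poly_block_char_poly:
  "poly (block_char_poly T M) x =
     Determinant.det (Matrix.mat M M (\<lambda>(i, j). (if i = j then x else 0) - T i j))"
proof -
  have "leading_block T M \<in> carrier_mat M M" by (simp add: leading_block_def)
  then have "poly (block_char_poly T M) x = Determinant.det (- char_matrix (leading_block T M) x)"
    unfolding block_char_poly_def by (rule char_poly_matrix)
  also have "- char_matrix (leading_block T M) x =
      Matrix.mat M M (\<lambda>(i, j). (if i = j then x else 0) - T i j)"
    by (rule eq_matI) (auto simp: char_matrix_def leading_block_def)
  finally show ?thesis .
qed

lemma prod_list_diag_mat_mat:
  "prod_list (diag_mat (Matrix.mat n n f)) = (\<Prod>i<n. f (i, i) :: 'a :: comm_ring_1)"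
proof -
  have "diag_mat (Matrix.mat n n f) = map (\<lambda>i. f (i, i)) [0..<n]"
    unfolding diag_mat_def by (rule map_cong) auto
  then show ?thesis by (simp add: prod.distinct_set_conv_list[symmetric] atLeast0LessThan[symmetric])
qed

text \<open>
  With \<open>C\<close> consisting of the first \<open>M\<close> rows of \<open>x - T\<close> completed by unit rows, and \<open>D\<close> of the
  solutions \<open>b\<close> completed by unit columns, both determinants in question occur in \<open>det (C D)\<close>.
\<close>

lemma det_shift_minus_band:
  fixes b :: "nat \<Rightarrow> nat \<Rightarrow> real"
  assumes q: "0 < q" and band: "\<And>i j. i + q < j \<Longrightarrow> T i j = 0"
    and rec: "\<And>n c. c < q \<Longrightarrow> (\<Sum>l\<le>n + q. T n l * b l c) = x * b n c"
    and init: "\<And>n c. n < q \<Longrightarrow> c < q \<Longrightarrow> b n c = \<xi> $$ (n, c)"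
    and \<xi>: "lower_unitriangular q \<xi>"
  shows "Determinant.det (Matrix.mat M M (\<lambda>(i, j). (if i = j then x else 0) - T i j)) =
    (- 1) ^ ((q - 1) * M) * (\<Prod>i<M. T i (i + q)) *
    Determinant.det (Matrix.mat q q (\<lambda>(i, c). b (M + i) c))"
proof -
  define S where "S i l = (if i = l then x else 0) - T i l" for i l
  define C where "C = Matrix.mat (M + q) (M + q)
    (\<lambda>(i, j). if i < M then S i j else if j = i then 1 else (0 :: real))"
  \<comment> \<open>\<open>C\<close> with its unit rows moved to the top. They then pick rows M,
    ..., M+q-1 of \<open>D\<close>, and the product becomes block triangular.\<close>
  define C' where "C' = Matrix.mat (M + q) (M + q)
    (\<lambda>(i, j). if i < q then if j = M + i then 1 else 0 else S (i - q) j)"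
  define D where "D = Matrix.mat (M + q) (M + q)
    (\<lambda>(l, c). if c < q then b l c else if l = c then 1 else (0 :: real))"
  \<comment> \<open>The shift by \<open>q\<close> puts the outermost superdiagonal of
    \<open>T\<close> on the diagonal and makes \<open>L\<close> lower triangular.\<close>
  define L where "L = Matrix.mat M M (\<lambda>(i, j). S i (j + q))"
  define B where "B = Matrix.mat q q (\<lambda>(i, c). b (M + i) c)"
  have carr: "C \<in> carrier_mat (M + q) (M + q)" "C' \<in> carrier_mat (M + q) (M + q)"
    "D \<in> carrier_mat (M + q) (M + q)" by (simp_all add: C_def C'_def D_def)
  have C: "C = four_block_mat (Matrix.mat M M (\<lambda>(i, j). S i j)) (Matrix.mat M q (\<lambda>(i, j). S i (j + M)))
      (0\<^sub>m q M) (1\<^sub>m q)"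
    by (rule eq_matI) (auto simp: C_def)
  have "Determinant.det C = Determinant.det (Matrix.mat M M (\<lambda>(i, j). S i j)) * Determinant.det (1\<^sub>m q)"
    unfolding C by (rule det_four_block_mat_lower_left_zero) auto
  then have detC: "Determinant.det C = Determinant.det (Matrix.mat M M (\<lambda>(i, j). S i j))" by simp
  have "Determinant.det C' = (- 1) ^ (q * M) * Determinant.det (Matrix.mat (M + q) (M + q)
      (\<lambda>(i, j). C' $$ (if i < M then i + q else if i < q + M then i - M else i, j)))"
    by (rule det_swap_initial_rows[OF carr(2)]) simp
  also have "Matrix.mat (M + q) (M + q)
      (\<lambda>(i, j). C' $$ (if i < M then i + q else if i < q + M then i - M else i, j)) = C"
    by (rule eq_matI) (auto simp: C_def C'_def)
  finally have detC': "Determinant.det C' = (- 1) ^ (q * M) * Determinant.det C" .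
  have "Determinant.det D = prod_list (diag_mat D)"
  proof (rule det_lower_triangular[OF _ carr(3)])
    fix i j assume "i < j" "j < M + q"
    then show "D $$ (i, j) = 0"
      using \<xi> init[of i j] by (auto simp: D_def lower_unitriangular_def)
  qed
  also have "\<dots> = (\<Prod>i<M + q. 1)"
    unfolding D_def prod_list_diag_mat_mat
    by (rule prod.cong) (use \<xi> init in \<open>auto simp: lower_unitriangular_def\<close>)
  finally have detD: "Determinant.det D = 1" by simp
  \<comment> \<open>Rows below \<open>M\<close> end before column M+q, so the finite sum is the
    complete recursion.\<close>
  have zero: "(\<Sum>l<M + q. S i l * b l c) = 0" if "i < M" "c < q" for i c
  proof -
    have "(\<Sum>l<M + q. T i l * b l c) = (\<Sum>l\<le>i + q. T i l * b l c)"
      by (rule sum.mono_neutral_right) (use that band in \<open>auto simp: not_le\<close>)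
    moreover have "(\<Sum>l<M + q. (if i = l then x else 0) * b l c) = x * b i c"
      using that by (simp add: if_distrib[of "\<lambda>a. a * _"] cong: if_cong)
    ultimately show ?thesis using rec[OF that(2), of i]
      by (simp add: S_def left_diff_distrib sum_subtractf)
  qed
  have CD: "(C' * D) $$ (i, j) = (\<Sum>l<M + q. C' $$ (i, l) * D $$ (l, j))"
    if "i < M + q" "j < M + q" for i j
    using that carr by (simp add: scalar_prod_def atLeast0LessThan)
  have delta: "(\<Sum>l<n. f l * (if l = j then 1 else 0)) = f j" "(\<Sum>l<n. (if l = j then 1 else 0) * f l) = f j"
    if "j < n" for f :: "nat \<Rightarrow> real" and n j
    using that by (simp_all add: if_distrib[of "\<lambda>a. a * _"] if_distrib[of "\<lambda>a. _ * a"] cong: if_cong)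
  have "C' * D = four_block_mat B (Matrix.mat q M (\<lambda>(i, j). C' $$ (i, j + q))) (0\<^sub>m M q) L"
  proof (rule eq_matI)
    fix i j assume "i < dim_row (four_block_mat B (Matrix.mat q M (\<lambda>(i, j). C' $$ (i, j + q))) (0\<^sub>m M q) L)"
      "j < dim_col (four_block_mat B (Matrix.mat q M (\<lambda>(i, j). C' $$ (i, j + q))) (0\<^sub>m M q) L)"
    then have ij: "i < M + q" "j < M + q" by (auto simp: B_def L_def)
    show "(C' * D) $$ (i, j) =
      four_block_mat B (Matrix.mat q M (\<lambda>(i, j). C' $$ (i, j + q))) (0\<^sub>m M q) L $$ (i, j)"
    proof (cases "j < q")
      case False
      have "(C' * D) $$ (i, j) = (\<Sum>l<M + q. C' $$ (i, l) * (if l = j then 1 else 0))"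
        unfolding CD[OF ij] using False ij by (intro sum.cong) (auto simp: D_def)
      also have "\<dots> = C' $$ (i, j)" by (rule delta(1)[OF ij(2)])
      finally show ?thesis using False ij by (auto simp: B_def L_def C'_def)
    next
      case j: True
      show ?thesis
      proof (cases "i < q")
        case True
        have "(C' * D) $$ (i, j) = (\<Sum>l<M + q. (if l = M + i then 1 else 0) * b l j)"
          unfolding CD[OF ij] using True j ij by (intro sum.cong) (auto simp: D_def C'_def)
        also have "\<dots> = b (M + i) j" using True by (intro delta(2)) simp
        finally show ?thesis using True j by (simp add: B_def L_def)
      next
        case False
        have "(C' * D) $$ (i, j) = (\<Sum>l<M + q. S (i - q) l * b l j)"
          unfolding CD[OF ij] using False j ij by (intro sum.cong) (auto simp: D_def C'_def)
        also have "\<dots> = 0" using False ij j by (intro zero) auto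
        finally show ?thesis using False j ij by (auto simp: B_def L_def)
      qed
    qed
  qed (use carr in \<open>auto simp: B_def L_def\<close>)
  then have "Determinant.det (C' * D) = Determinant.det B * Determinant.det L"
    by (simp only:, subst det_four_block_mat_lower_left_zero[of _ q _ M]) (auto simp: B_def L_def)
  then have detC'2: "Determinant.det C' = Determinant.det B * Determinant.det L"
    using det_mult[OF carr(2,3)] detD by simp
  have "Determinant.det L = prod_list (diag_mat L)"
    by (rule det_lower_triangular[of M]) (auto simp: L_def S_def band)
  also have "\<dots> = (\<Prod>i<M. - T i (i + q))"
    unfolding L_def prod_list_diag_mat_mat using q by (simp add: S_def)
  also have "\<dots> = (- 1) ^ M * (\<Prod>i<M. T i (i + q))" by (simp add: prod_uminus)
  finally have detL: "Determinant.det L = (- 1) ^ M * (\<Prod>i<M. T i (i + q))" .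
  \<comment> \<open>Moving the rows costs the first power, the diagonal of \<open>L\<close> the
    second; together they form the sign in \<open>\<beta>_coeff\<close>.\<close>
  have sign: "(- 1 :: real) ^ (q * M) * (- 1) ^ M = (- 1) ^ ((q - 1) * M)"
  proof -
    obtain r where r: "q = Suc r" using q gr0_implies_Suc by blast
    have "(- 1 :: real) ^ (q * M) * (- 1) ^ M = (- 1) ^ (r * M) * ((- 1) ^ M * (- 1) ^ M)"
      by (simp add: r power_add)
    then show ?thesis by (simp add: r power_mult_distrib[symmetric])
  qed
  have "Determinant.det C = ((- 1) ^ (q * M) * (- 1) ^ (q * M)) * Determinant.det C"
    by (simp add: power_mult_distrib[symmetric])
  also have "\<dots> = (- 1) ^ (q * M) * Determinant.det C'" by (simp only: detC' mult.assoc)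
  also have "\<dots> = (- 1) ^ ((q - 1) * M) * (\<Prod>i<M. T i (i + q)) * Determinant.det B"
    unfolding detC'2 detL sign[symmetric] by simp
  finally show ?thesis unfolding detC S_def[abs_def] B_def .
qed

text \<open>Only right polynomials are treated; the left ones are an instance, for the transposed
  matrix with \<open>p\<close> and \<open>q\<close> exchanged.\<close>

locale recursion_polys =
  fixes p q :: nat and T :: smat and \<xi> :: "real mat"
  assumes q: "0 < q" and pos_band: "positive_band p q T" and \<xi>: "lower_unitriangular q \<xi>"
begin

lemma band: "i + q < j \<Longrightarrow> T i j = 0"
  using pos_band[unfolded positive_band_def, rule_format, of i j] by (auto split: if_splits)

definition b :: "real \<Rightarrow> nat \<Rightarrow> nat \<Rightarrow> real" where
  "b x l c = poly (right_poly q T \<xi> c l) x"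

lemma b_init: "n < q \<Longrightarrow> b x n c = \<xi> $$ (n, c)"
  by (simp add: b_def right_poly(1)[OF q pos_band])

lemma b_rec: "(\<Sum>l\<le>n + q. T n l * b x l c) = x * b x n c"
  using arg_cong[OF right_poly(2)[OF q pos_band, of n \<xi> c], of "\<lambda>r. poly r x"]
  by (simp add: b_def poly_sum)

definition rdet :: "real \<Rightarrow> nat \<Rightarrow> nat \<Rightarrow> real" where
  "rdet x N n = Determinant.det (Matrix.mat q q (\<lambda>(i, c). b x (if i = 0 then n else N + i) c))"

lemma poly_R_poly: "poly (R_poly q T \<xi> n N) x = rdet x N n"
  unfolding R_poly_def rdet_def by (rule poly_det_cong[of _ q]) (auto simp: b_def)

text \<open>Expansion along row 0, the only row that depends on \<open>n\<close>. As a fixed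
  combination of solutions, \<open>rdet\<close> inherits their recursion.\<close>

lemma rdet_linear: "\<exists>\<kappa>. \<forall>n. rdet x N n = (\<Sum>c<q. b x n c * \<kappa> c)"
proof -
  define A where "A n = Matrix.mat q q (\<lambda>(i, c). b x (if i = 0 then n else N + i) c)" for n
  have del: "mat_delete (A n) 0 c = mat_delete (A 0) 0 c" for n c
    by (rule eq_matI) (auto simp: mat_delete_def A_def)
  have cof: "cofactor (A n) 0 c = cofactor (A 0) 0 c" for n c
    unfolding cofactor_def by (subst del) (rule refl)
  have "rdet x N n = (\<Sum>c<q. b x n c * cofactor (A 0) 0 c)" for n
  proof -
    have "rdet x N n = (\<Sum>c<q. A n $$ (0, c) * cofactor (A n) 0 c)"
      unfolding rdet_def A_def[symmetric] using q by (intro laplace_expansion_row) (auto simp: A_def)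
    also have "\<dots> = (\<Sum>c<q. b x n c * cofactor (A 0) 0 c)"
    proof (intro sum.cong refl)
      fix c assume "c \<in> {..<q}"
      then have "A n $$ (0, c) = b x n c" using q by (simp add: A_def)
      then show "A n $$ (0, c) * cofactor (A n) 0 c = b x n c * cofactor (A 0) 0 c"
        by (simp only: cof[of n c])
    qed
    finally show ?thesis .
  qed
  then show ?thesis by blast
qed

lemma rdet_rec: "(\<Sum>l\<le>n + q. T n l * rdet x N l) = x * rdet x N n"
proof -
  obtain \<kappa> where \<kappa>: "\<And>n. rdet x N n = (\<Sum>c<q. b x n c * \<kappa> c)" using rdet_linear by blast
  have "(\<Sum>l\<le>n + q. T n l * rdet x N l) = (\<Sum>l\<le>n + q. \<Sum>c<q. (T n l * b x l c) * \<kappa> c)"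
    by (simp add: \<kappa> sum_distrib_left mult.assoc)
  also have "\<dots> = (\<Sum>c<q. \<Sum>l\<le>n + q. (T n l * b x l c) * \<kappa> c)" by (rule sum.swap)
  also have "\<dots> = (\<Sum>c<q. (x * b x n c) * \<kappa> c)" by (simp only: sum_distrib_right[symmetric] b_rec)
  finally show ?thesis by (simp add: \<kappa> sum_distrib_left mult.assoc)
qed

text \<open>The zeros just beyond N: they close the recursion on 0, ..., N up to the single term at
  N+q.\<close>

lemma rdet_repeated: "N < n \<Longrightarrow> n < N + q \<Longrightarrow> rdet x N n = 0"
  unfolding rdet_def
  by (rule det_identical_rows[of _ q 0 "n - N"]) (auto intro!: eq_vecI)

lemma poly_block_char_poly_eq:
  "poly (block_char_poly T M) x =
    \<beta>_coeff q T M * Determinant.det (Matrix.mat q q (\<lambda>(i, c). b x (M + i) c))"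
  unfolding poly_block_char_poly \<beta>_coeff_def
  by (rule det_shift_minus_band[OF q band]) (auto simp: b_rec b_init \<xi>)

lemma rdet_last: "\<beta>_coeff q T N * rdet x N N = poly (block_char_poly T N) x"
proof -
  have "Matrix.mat q q (\<lambda>(i, c). b x (if i = 0 then N else N + i) c)
      = Matrix.mat q q (\<lambda>(i, c). b x (N + i) c)"
    by (rule eq_matI) auto
  then show ?thesis by (simp add: rdet_def poly_block_char_poly_eq)
qed

text \<open>Moving row N+q from the top to the bottom costs (-1)^(q-1), exactly the sign by which
  \<open>\<beta>_coeff\<close> at N+1 differs from that at N.\<close>

lemma rdet_next:
  "\<beta>_coeff q T N * (T N (N + q) * rdet x N (N + q)) = poly (block_char_poly T (Suc N)) x"
proof -
  let ?A = "Matrix.mat q q (\<lambda>(i, c). b x (Suc N + i) c)"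
  have "Determinant.det ?A = (- 1) ^ ((q - 1) * 1) * Determinant.det (Matrix.mat q q
      (\<lambda>(i, j). ?A $$ (if i < 1 then i + (q - 1) else if i < (q - 1) + 1 then i - 1 else i, j)))"
    by (rule det_swap_initial_rows) (use q in auto)
  also have "Matrix.mat q q
      (\<lambda>(i, j). ?A $$ (if i < 1 then i + (q - 1) else if i < (q - 1) + 1 then i - 1 else i, j))
    = Matrix.mat q q (\<lambda>(i, c). b x (if i = 0 then N + q else N + i) c)"
    using q by (intro eq_matI) auto
  finally have det: "Determinant.det ?A = (- 1) ^ (q - 1) * rdet x N (N + q)"
    by (simp add: rdet_def)
  have sq: "(- 1 :: real) ^ k * (- 1) ^ k = 1" for k
    by (simp add: power_mult_distrib[symmetric])
  have "(q - 1) * Suc N = (q - 1) + (q - 1) * N" by simp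
  then have "(- 1 :: real) ^ ((q - 1) * Suc N) * (- 1) ^ (q - 1)
      = (- 1) ^ ((q - 1) * N) * ((- 1) ^ (q - 1) * (- 1) ^ (q - 1))"
    by (simp only: power_add mult_ac)
  then have sign: "(- 1 :: real) ^ ((q - 1) * Suc N) * (- 1) ^ (q - 1) = (- 1) ^ ((q - 1) * N)"
    unfolding sq by simp
  have "poly (block_char_poly T (Suc N)) x =
      ((- 1) ^ ((q - 1) * Suc N) * (- 1) ^ (q - 1)) * (\<Prod>i<Suc N. T i (i + q)) * rdet x N (N + q)"
    unfolding poly_block_char_poly_eq det \<beta>_coeff_def by (simp only: mult_ac)
  then show ?thesis unfolding sign \<beta>_coeff_def by simp
qed

definition rpoly :: "nat \<Rightarrow> nat \<Rightarrow> real poly" where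
  "rpoly N n = Polynomial.smult (\<beta>_coeff q T N) (R_poly q T \<xi> n N)"

lemma poly_rpoly_last: "poly (rpoly N N) x = poly (block_char_poly T N) x"
  by (simp add: rpoly_def poly_R_poly rdet_last)

text \<open>The truncated eigenvector equation with its residual. The residual sits in row N and is
  the next characteristic polynomial, so at its roots the vector is annihilated by x - T.\<close>

lemma poly_rpoly_rec:
  assumes "n \<le> N"
  shows "x * poly (rpoly N n) x - (\<Sum>l\<le>N. T n l * poly (rpoly N l) x) =
    (if n = N then poly (block_char_poly T (Suc N)) x else 0)"
proof -
  define U where "U l = \<beta>_coeff q T N * rdet x N l" for l
  have "x * U n = \<beta>_coeff q T N * (\<Sum>l\<le>n + q. T n l * rdet x N l)" by (simp add: U_def rdet_rec)
  also have "\<dots> = (\<Sum>l\<le>n + q. T n l * U l)" by (simp add: U_def sum_distrib_left mult_ac)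
  also have "\<dots> = (\<Sum>l\<le>N + q. T n l * U l)"
    by (rule sum.mono_neutral_left) (use assms band[of n] in \<open>auto simp: not_le\<close>)
  also have "\<dots> = (\<Sum>l\<in>insert (N + q) {..N}. T n l * U l)"
    by (rule sum.mono_neutral_right) (auto simp: U_def intro!: rdet_repeated)
  also have "\<dots> = T n (N + q) * U (N + q) + (\<Sum>l\<le>N. T n l * U l)"
    using q by (subst sum.insert) auto
  finally have "x * U n - (\<Sum>l\<le>N. T n l * U l) = T n (N + q) * U (N + q)" by simp
  also have "\<dots> = (if n = N then poly (block_char_poly T (Suc N)) x else 0)"
    using assms band[of n "N + q"] rdet_next[of N x] by (auto simp: U_def mult_ac)
  finally show ?thesis by (simp add: U_def rpoly_def poly_R_poly)
qed

end

section \<open>Finite spectral representation of the powers\<close>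

lemma christoffel_first:
  assumes "lower_unitriangular d \<nu>" "0 < d"
  shows "(the (mat_inverse \<nu>) *\<^sub>v Matrix.vec d f) $ 0 = f 0"
proof -
  have \<nu>: "\<nu> \<in> carrier_mat d d" using assms(1) by (simp add: lower_unitriangular_def)
  have "Determinant.det \<nu> = prod_list (diag_mat \<nu>)"
    by (rule det_lower_triangular[OF _ \<nu>]) (use assms(1) in \<open>auto simp: lower_unitriangular_def\<close>)
  also have "\<dots> = 1"
    using assms(1) by (intro prod_list_neutral) (auto simp: diag_mat_def lower_unitriangular_def)
  finally have "\<nu> \<in> Units (ring_mat TYPE(real) d ())" by (intro det_non_zero_imp_unit[OF \<nu>]) simp
  then obtain B where B: "mat_inverse \<nu> = Some B"
    using mat_inverse(1)[OF \<nu>, where b = "()"] by (cases "mat_inverse \<nu>") auto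
  have inv: "\<nu> * B = 1\<^sub>m d" "B \<in> carrier_mat d d" using mat_inverse(2)[OF \<nu> B] by auto
  \<comment> \<open>The first row of \<open>\<nu>\<close> is a unit row, so the first row of
    \<open>\<nu> * B\<close> is the first row of the inverse itself.\<close>
  have "B $$ (0, j) = (if j = 0 then 1 else 0)" if "j < d" for j
  proof -
    have "(\<nu> * B) $$ (0, j) = (\<Sum>k<d. \<nu> $$ (0, k) * B $$ (k, j))"
      using \<nu> inv(2) assms(2) that by (simp add: scalar_prod_def atLeast0LessThan)
    also have "\<dots> = (\<Sum>k<d. if k = 0 then B $$ (k, j) else 0)"
      using assms by (intro sum.cong) (auto simp: lower_unitriangular_def)
    finally show ?thesis using assms(2) that by (simp add: inv(1))
  qed
  then have "row B 0 \<bullet> Matrix.vec d f = (\<Sum>k<d. (if k = 0 then 1 else 0) * f k)"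
    using inv(2) assms(2) by (simp add: scalar_prod_def atLeast0LessThan)
  also have "\<dots> = f 0"
    using assms(2) by (simp add: if_distrib[of "\<lambda>a. a * _"] cong: if_cong)
  finally have "row B 0 \<bullet> Matrix.vec d f = f 0" .
  then show ?thesis using B inv assms(2) by simp
qed

lemma ev_enumerates:
  assumes "finite (spectrum (leading_block T (Suc N)))" "card (spectrum (leading_block T (Suc N))) = Suc N"
  shows "inj_on (ev T N) {..N}" "k \<le> N \<Longrightarrow> eigenvalue (leading_block T (Suc N)) (ev T N k)"
proof -
  define xs where "xs = rev (sorted_list_of_set (spectrum (leading_block T (Suc N))))"
  have xs: "distinct xs" "length xs = Suc N" "set xs = spectrum (leading_block T (Suc N))"
    using assms by (simp_all add: xs_def)
  have ev: "ev T N k = xs ! k" for k by (simp add: ev_def xs_def)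
  show "inj_on (ev T N) {..N}"
    unfolding ev[abs_def] using xs by (auto simp: inj_on_def nth_eq_iff_index_eq)
  show "eigenvalue (leading_block T (Suc N)) (ev T N k)" if "k \<le> N"
    using nth_mem[of k xs] that xs unfolding ev by (simp add: spectrum_def)
qed

text \<open>Compare both sides of the eigenvector equation at an entry of maximal modulus; truncated
  rows sum to at most 1.\<close>

lemma eigenvalue_leading_block_bound:
  assumes "stochastic T" "eigenvalue (leading_block T n) r"
  shows "\<bar>r\<bar> \<le> 1"
proof -
  obtain v where v: "v \<in> carrier_vec n" "v \<noteq> 0\<^sub>v n" "leading_block T n *\<^sub>v v = r \<cdot>\<^sub>v v"
    using assms(2) unfolding eigenvalue_def eigenvector_def by (auto simp: leading_block_def)
  define m where "m = Max ((\<lambda>i. \<bar>v $ i\<bar>) ` {..<n})"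
  obtain i0 where i0: "i0 < n" "v $ i0 \<noteq> 0"
    using v(1,2) by (metis carrier_vecD eq_vecI index_zero_vec)
  have le: "\<bar>v $ l\<bar> \<le> m" if "l < n" for l
    unfolding m_def using that by (intro Max_ge) auto
  have "m \<in> (\<lambda>i. \<bar>v $ i\<bar>) ` {..<n}"
    unfolding m_def using i0 by (intro Max_in) auto
  then obtain i where i: "i < n" "m = \<bar>v $ i\<bar>" by auto
  have m: "0 < m" using le[OF i0(1)] i0 by simp
  have "(leading_block T n *\<^sub>v v) $ i = (\<Sum>l<n. T i l * v $ l)"
    using v(1) i by (simp add: leading_block_def scalar_prod_def atLeast0LessThan)
  then have "r * v $ i = (\<Sum>l<n. T i l * v $ l)" using v(1) i unfolding v(3) by simp
  then have "\<bar>r\<bar> * m = \<bar>\<Sum>l<n. T i l * v $ l\<bar>" by (simp add: i abs_mult[symmetric])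
  also have "\<dots> \<le> (\<Sum>l<n. T i l * m)"
    using assms(1) le by (intro order_trans[OF sum_abs] sum_mono)
      (auto simp: abs_mult stochastic_def intro!: mult_left_mono)
  also have "\<dots> = (\<Sum>l<n. T i l) * m" by (simp add: sum_distrib_right)
  also have "\<dots> \<le> 1 * m"
  proof (rule mult_right_mono)
    have "T i sums 1" using assms(1) by (simp add: stochastic_def)
    then show "(\<Sum>l<n. T i l) \<le> 1"
      using sum_le_suminf[of "T i" "{..<n}"] assms(1) by (simp add: sums_iff stochastic_def)
  qed (use m in simp)
  finally show ?thesis using m by simp
qed

text \<open>
  The bilinear form of the two eigenvector polynomials is a Christoffel--Darboux kernel; its value on
  the diagonal is obtained by differentiating.
\<close>

lemma christoffel_darboux:
  fixes U W :: "nat \<Rightarrow> real poly" and P0 P1 :: "real poly"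
  assumes U: "\<And>n x. n \<le> N \<Longrightarrow> x * poly (U n) x - (\<Sum>l\<le>N. T n l * poly (U l) x) =
      (if n = N then poly P1 x else 0)"
    and W: "\<And>n x. n \<le> N \<Longrightarrow> x * poly (W n) x - (\<Sum>l\<le>N. T l n * poly (W l) x) =
      (if n = N then poly P1 x else 0)"
    and WN: "poly (W N) r = poly P0 r" and r: "poly P1 r = 0"
  shows "s \<noteq> r \<Longrightarrow> poly P1 s = 0 \<Longrightarrow> (\<Sum>n\<le>N. poly (W n) r * poly (U n) s) = 0"
    and "(\<Sum>n\<le>N. poly (W n) r * poly (U n) r) = poly P0 r * poly (pderiv P1) r"
proof -
  define K where "K = (\<Sum>n\<le>N. Polynomial.smult (poly (W n) r) (U n))"
  have polyK: "poly K x = (\<Sum>n\<le>N. poly (W n) r * poly (U n) x)" for x by (simp add: K_def poly_sum)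
  have left: "(\<Sum>n\<le>N. T n l * poly (W n) r) = r * poly (W l) r" if "l \<le> N" for l
    using W[OF that, of r] r by (simp split: if_splits)
  have "(x - r) * poly K x = poly P0 r * poly P1 x" for x
  \<comment> \<open>The matrix is moved over to the left vector, which is an eigenvector at the root
    \<open>r\<close>; of the right vector only the residual in entry \<open>N\<close>
    survives.\<close>
  proof -
    have "(\<Sum>n\<le>N. poly (W n) r * (\<Sum>l\<le>N. T n l * poly (U l) x)) =
        (\<Sum>n\<le>N. \<Sum>l\<le>N. T n l * poly (W n) r * poly (U l) x)"
      by (simp add: sum_distrib_left mult_ac)
    also have "\<dots> = (\<Sum>l\<le>N. \<Sum>n\<le>N. T n l * poly (W n) r * poly (U l) x)" by (rule sum.swap)
    also have "\<dots> = (\<Sum>l\<le>N. r * poly (W l) r * poly (U l) x)"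
      by (simp add: sum_distrib_right[symmetric] left)
    also have "\<dots> = r * poly K x" by (simp add: polyK sum_distrib_left mult_ac)
    finally have 1: "(\<Sum>n\<le>N. poly (W n) r * (\<Sum>l\<le>N. T n l * poly (U l) x)) = r * poly K x" .
    have "(x - r) * poly K x = x * poly K x - (\<Sum>n\<le>N. poly (W n) r * (\<Sum>l\<le>N. T n l * poly (U l) x))"
      unfolding 1 by (simp add: left_diff_distrib)
    also have "\<dots> = (\<Sum>n\<le>N. poly (W n) r * (x * poly (U n) x - (\<Sum>l\<le>N. T n l * poly (U l) x)))"
      by (simp add: polyK sum_distrib_left right_diff_distrib sum_subtractf mult_ac)
    also have "\<dots> = (\<Sum>n\<le>N. if n = N then poly (W n) r * poly P1 x else 0)"
      using U by (intro sum.cong) auto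
    finally show ?thesis by (simp add: WN)
  qed
  then have "poly ([:- r, 1:] * K) x = poly (Polynomial.smult (poly P0 r) P1) x" for x
    by (simp add: algebra_simps)
  then have K: "[:- r, 1:] * K = Polynomial.smult (poly P0 r) P1"
    unfolding poly_eq_poly_eq_iff[symmetric] by (rule ext)
  show "(\<Sum>n\<le>N. poly (W n) r * poly (U n) s) = 0" if "s \<noteq> r" "poly P1 s = 0"
    using arg_cong[OF K, of "\<lambda>f. poly f s"] that by (simp add: polyK)
  \<comment> \<open>By the product rule the factor x - r drops out at \<open>r\<close>, giving the
    diagonal value without a limit.\<close>
  have "poly (pderiv ([:- r, 1:] * K)) r = poly K r"
    by (simp only: pderiv_mult poly_add poly_mult) (simp add: pderiv_pCons)
  then show "(\<Sum>n\<le>N. poly (W n) r * poly (U n) r) = poly P0 r * poly (pderiv P1) r"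
    unfolding K by (simp add: pderiv_smult polyK)
qed

text \<open>Biorthonormality is a one-sided inverse of a square matrix, hence a two-sided one, and
  the other side is completeness.\<close>

lemma biorthonormal_complete:
  fixes u w :: "nat \<Rightarrow> nat \<Rightarrow> real"
  assumes "\<And>k l. k \<le> N \<Longrightarrow> l \<le> N \<Longrightarrow> (\<Sum>n\<le>N. w k n * u l n) = (if k = l then 1 else 0)"
    and "n \<le> N" "m \<le> N"
  shows "(\<Sum>k\<le>N. u k n * w k m) = (if n = m then 1 else 0)"
proof -
  define A where "A = Matrix.mat (Suc N) (Suc N) (\<lambda>(k, n). w k n)"
  define B where "B = Matrix.mat (Suc N) (Suc N) (\<lambda>(n, k). u k n)"
  have carr: "A \<in> carrier_mat (Suc N) (Suc N)" "B \<in> carrier_mat (Suc N) (Suc N)"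
    by (simp_all add: A_def B_def)
  have "A * B = 1\<^sub>m (Suc N)"
    by (rule eq_matI)
      (auto simp: A_def B_def scalar_prod_def assms(1) atLeast0LessThan lessThan_Suc_atMost less_Suc_eq_le
        simp del: sum.lessThan_Suc)
  from mat_mult_left_right_inverse[OF carr this] have "(B * A) $$ (n, m) = 1\<^sub>m (Suc N) $$ (n, m)" by simp
  then show ?thesis
    using assms(2,3) by (simp add: A_def B_def scalar_prod_def atLeast0LessThan lessThan_Suc_atMost
        less_Suc_eq_le del: sum.lessThan_Suc)
qed

text \<open>k steps climb by at most k q, so a path starting at n with
  \<open>n + k * q \<le> N\<close> never leaves the truncation and its power agrees with the
  infinite one.\<close>

lemma (in banded_chain) pw_spectral:
  assumes eig: "\<And>j n. j \<le> N \<Longrightarrow> n \<le> N \<Longrightarrow> (\<Sum>l\<le>N. T n l * u j l) = r j * u j n"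
    and complete: "\<And>n m. n \<le> N \<Longrightarrow> m \<le> N \<Longrightarrow> (\<Sum>j\<le>N. u j n * w j m) = (if n = m then 1 else 0)"
    and "n + k * q \<le> N" "m \<le> N"
  shows "pw k n m = (\<Sum>j\<le>N. u j n * w j m * r j ^ k)"
  using assms(3)
proof (induction k arbitrary: n)
  case 0
  then show ?case using complete[of n m] assms(4) by (simp add: smat_one_def)
next
  case (Suc k)
  have n: "n + q \<le> N" "n \<le> N" using Suc.prems by (auto simp: algebra_simps)
  have "pw (Suc k) n m = (\<Sum>l\<le>n + q. T n l * (\<Sum>j\<le>N. u j l * w j m * r j ^ k))"
    unfolding smat_power.simps
  proof (intro sum.cong refl)
    fix l assume "l \<in> {..n + q}"
    then have "l + k * q \<le> N" using Suc.prems by simp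
    then show "T n l * pw k l m = T n l * (\<Sum>j\<le>N. u j l * w j m * r j ^ k)" using Suc.IH by simp
  qed
  also have "\<dots> = (\<Sum>l\<le>N. T n l * (\<Sum>j\<le>N. u j l * w j m * r j ^ k))"
    by (rule sum.mono_neutral_left) (use n band[of n] in \<open>auto simp: not_le\<close>)
  also have "\<dots> = (\<Sum>l\<le>N. \<Sum>j\<le>N. T n l * u j l * (w j m * r j ^ k))"
    by (simp add: sum_distrib_left mult_ac)
  also have "\<dots> = (\<Sum>j\<le>N. \<Sum>l\<le>N. T n l * u j l * (w j m * r j ^ k))" by (rule sum.swap)
  also have "\<dots> = (\<Sum>j\<le>N. r j * u j n * (w j m * r j ^ k))"
    by (simp add: sum_distrib_right[symmetric] eig n(2))
  finally show ?case by (simp add: mult_ac)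
qed

lemma block_char_poly_transpose: "block_char_poly (\<lambda>i j. T j i) M = block_char_poly T M"
proof -
  have "leading_block (\<lambda>i j. T j i) M = transpose_mat (leading_block T M)"
    by (rule eq_matI) (auto simp: leading_block_def)
  then show ?thesis
    unfolding block_char_poly_def by (simp add: char_poly_transpose_mat[of _ M] leading_block_def)
qed

lemma Q_poly_transpose: "Q_poly p T \<nu> n N = R_poly p (\<lambda>i j. T j i) \<nu> n N"
  unfolding Q_poly_def R_poly_def left_poly_def right_poly_def ..

lemma \<alpha>_coeff_transpose: "\<alpha>_coeff p T N = \<beta>_coeff p (\<lambda>i j. T j i) N"
  unfolding \<alpha>_coeff_def \<beta>_coeff_def ..

text \<open>A Gauss quadrature property: the discrete measure has the exact moments of the chain up
  to an order that grows with N.\<close>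

lemma discrete_spectral_representation:
  assumes "1 \<le> p" "1 \<le> q" and T: "stochastic T" "positive_band p q T"
    and fact: "positive_bidiagonal_factorization p q T"
    and \<nu>\<xi>: "lower_unitriangular p \<nu>" "lower_unitriangular q \<xi>"
    and pos: "\<And>k. k \<le> N \<Longrightarrow> 0 < christoffel_\<mu> p T \<nu> N k 0"
    and "m * q \<le> N"
  shows "(\<Sum>k\<le>N. christoffel_\<rho> q T \<xi> N k 0 * christoffel_\<mu> p T \<nu> N k 0 * ev T N k ^ m)
    = smat_power q T m 0 0"
proof -
  let ?T' = "\<lambda>i j. T j i"
  have "positive_band q p ?T'"
    using T(2) unfolding positive_band_def by (simp add: conj_commute)
  interpret R: recursion_polys p q T \<xi>
    by (rule recursion_polys.intro) (use assms(2) T(2) \<nu>\<xi>(2) in simp_all)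
  interpret L: recursion_polys q p ?T' \<nu>
    by (rule recursion_polys.intro) (use assms(1) \<open>positive_band q p ?T'\<close> \<nu>\<xi>(1) in simp_all)
  interpret banded_chain q T by unfold_locales (rule T, rule R.band)
  let ?P0 = "block_char_poly T N" and ?P1 = "block_char_poly T (Suc N)"
  let ?r = "ev T N"
  note spec = ev_enumerates[OF spectrum_leading_block[OF fact assms(1,2)]]
  define u where "u k n = poly (R.rpoly N n) (?r k)" for k n
  define w where "w k n = poly (L.rpoly N n) (?r k) / (poly ?P0 (?r k) * poly (pderiv ?P1) (?r k))" for k n
  have root: "poly ?P1 (?r k) = 0" if "k \<le> N" for k
    using spec(2)[OF that] unfolding block_char_poly_def
    by (subst (asm) eigenvalue_root_char_poly[of _ "Suc N"]) (auto simp: leading_block_def)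
  have \<rho>: "christoffel_\<rho> q T \<xi> N k 0 = u k 0" for k
    unfolding christoffel_\<rho>_def christoffel_first[OF \<nu>\<xi>(2) R.q]
    by (simp add: u_vec_def u_def R.rpoly_def)
  have \<mu>: "christoffel_\<mu> p T \<nu> N k 0 = w k 0" for k
    unfolding christoffel_\<mu>_def christoffel_first[OF \<nu>\<xi>(1) L.q]
    by (simp add: w_vec_def w_def L.rpoly_def Q_poly_transpose \<alpha>_coeff_transpose)
  \<comment> \<open>Division by 0 yields 0, so a positive Christoffel number certifies that the
    denominator does not vanish.\<close>
  have nz: "poly ?P0 (?r k) * poly (pderiv ?P1) (?r k) \<noteq> 0" if "k \<le> N" for k
    using pos[OF that] unfolding \<mu> w_def by auto
  have Lrec: "x * poly (L.rpoly N n) x - (\<Sum>l\<le>N. T l n * poly (L.rpoly N l) x) =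
      (if n = N then poly ?P1 x else 0)" if "n \<le> N" for n x
    using L.poly_rpoly_rec[OF that, of x] unfolding block_char_poly_transpose[of T] .
  have Llast: "poly (L.rpoly N N) x = poly ?P0 x" for x
    using L.poly_rpoly_last[of N x] unfolding block_char_poly_transpose[of T] .
  note cd = christoffel_darboux[where T = T and U = "R.rpoly N" and W = "L.rpoly N" and ?P1.0 = ?P1 and ?P0.0 = ?P0,
    OF R.poly_rpoly_rec Lrec Llast root]
  have biorth: "(\<Sum>n\<le>N. w k n * u l n) = (if k = l then 1 else 0)" if "k \<le> N" "l \<le> N" for k l
  proof -
    let ?c = "poly ?P0 (?r k) * poly (pderiv ?P1) (?r k)"
    have "(\<Sum>n\<le>N. w k n * u l n) = (\<Sum>n\<le>N. poly (L.rpoly N n) (?r k) * poly (R.rpoly N n) (?r l)) / ?c"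
      by (simp add: w_def u_def sum_divide_distrib)
    also have "\<dots> = (if k = l then 1 else 0)"
    proof (cases "k = l")
      case True
      then show ?thesis using cd(2)[OF _ _ that(1)] nz[OF that(1)] by simp
    next
      case False
      then have "?r l \<noteq> ?r k" using spec(1) that by (auto dest: inj_onD)
      then show ?thesis using cd(1)[OF _ _ that(1) _ root[OF that(2)]] False by simp
    qed
    finally show ?thesis .
  qed
  have "smat_power q T m 0 0 = (\<Sum>j\<le>N. u j 0 * w j 0 * ?r j ^ m)"
  proof (rule pw_spectral)
    show "(\<Sum>l\<le>N. T n l * u j l) = ?r j * u j n" if "j \<le> N" "n \<le> N" for j n
      using R.poly_rpoly_rec[OF that(2), of "?r j"] root[OF that(1)] by (simp add: u_def split: if_splits)
    show "(\<Sum>j\<le>N. u j n * w j m) = (if n = m then 1 else 0)" if "n \<le> N" "m \<le> N" for n m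
      using biorthonormal_complete[OF biorth that] by simp
  qed (use assms in auto)
  then show ?thesis by (simp add: \<rho> \<mu>)
qed

section \<open>Moments of the limit measure and the theorem\<close>

lemma spectral_measure_moments:
  assumes "1 \<le> p" "1 \<le> q" and T: "stochastic T" "positive_band p q T"
    and fact: "positive_bidiagonal_factorization p q T"
    and \<nu>\<xi>: "lower_unitriangular p \<nu>" "lower_unitriangular q \<xi>"
    and pos: "eventually_positive_christoffel p q T \<nu> \<xi>"
    and \<psi>: "spectral_measures p q T \<nu> \<xi> \<psi>"
  shows "(\<integral>x. x ^ k \<partial>\<psi> 0 0) = smat_power q T k 0 0"
proof -
  have pq: "0 < p" "0 < q" using assms by auto
  have M: "finite_borel_measure (\<psi> 0 0)" "AE x in \<psi> 0 0. x \<in> {0..1}"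
    using \<psi> pq unfolding spectral_measures_def by blast+
  obtain r where r: "strict_mono r"
    and conv: "weak_conv_m (\<lambda>j. discrete_measure p q T \<nu> \<xi> (r j) 0 0) (\<psi> 0 0)"
    using \<psi> pq unfolding spectral_measures_def by blast
  obtain N0 where N0: "\<And>N k. N0 \<le> N \<Longrightarrow> k \<le> N \<Longrightarrow> 0 < christoffel_\<mu> p T \<nu> N k 0 \<and> 0 < christoffel_\<rho> q T \<xi> N k 0"
    using pos pq unfolding eventually_positive_christoffel_def eventually_sequentially by blast
  \<comment> \<open>Skips the indices below \<open>N0\<close>, where nonpositive weights might be
    cut off by \<open>ennreal\<close>.\<close>
  define R where "R j = r (j + N0)" for j
  have R: "N0 \<le> R j" "j \<le> R j" for j
    using seq_suble[OF r, of "j + N0"] by (simp_all add: R_def)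
  define D where "D j = discrete_measure p q T \<nu> \<xi> (R j) 0 0" for j
  have rep: "(\<Sum>k\<le>R j. christoffel_\<rho> q T \<xi> (R j) k 0 * christoffel_\<mu> p T \<nu> (R j) k 0 * ev T (R j) k ^ m)
      = smat_power q T m 0 0" if "m * q \<le> R j" for j m
    by (rule discrete_spectral_representation[OF assms(1,2) T fact \<nu>\<xi> _ that]) (use N0 R in auto)
  \<comment> \<open>The moment of order 0: the discrete measures are probability measures.\<close>
  have sum1: "(\<Sum>k\<le>R j. christoffel_\<rho> q T \<xi> (R j) k 0 * christoffel_\<mu> p T \<nu> (R j) k 0) = 1" for j
    using rep[of 0 j] by (simp add: smat_one_def)
  have nonneg: "0 \<le> christoffel_\<rho> q T \<xi> (R j) k 0 * christoffel_\<mu> p T \<nu> (R j) k 0" if "k \<le> R j" for j k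
    using N0[OF R(1) that] by simp
  have evb: "ev T (R j) k \<in> {- 1..1}" if "k \<le> R j" for j k
    using eigenvalue_leading_block_bound[OF T(1)
        ev_enumerates(2)[OF spectrum_leading_block[OF fact assms(1,2)] that]] by auto
  have D: "real_distribution (D j)" "AE x in D j. x \<in> {- 1..1}"
    "(\<integral>x. x ^ m \<partial>D j) =
      (\<Sum>k\<le>R j. christoffel_\<rho> q T \<xi> (R j) k 0 * christoffel_\<mu> p T \<nu> (R j) k 0 * ev T (R j) k ^ m)" for j m
    unfolding D_def discrete_measure_def
    subgoal by (rule distr_point_measure_moments(1)[where S = "{- 1..1}"]) (use nonneg sum1 evb in simp_all)
    subgoal by (rule distr_point_measure_moments(2)) (use nonneg sum1 evb in simp_all)
    subgoal by (rule distr_point_measure_moments(3)[where S = "{- 1..1}"]) (use nonneg sum1 evb in simp_all)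
    done
  have "(\<lambda>j. \<integral>x. x ^ k \<partial>D j) \<longlonglongrightarrow> (\<integral>x. x ^ k \<partial>\<psi> 0 0)"
  proof (rule weak_conv_moments)
    show "real_distribution (D j)" for j by (rule D(1))
    show "AE x in D j. x \<in> {- 1..1}" for j by (rule D(2))
    show "AE x in \<psi> 0 0. x \<in> {- 1..1}" using M(2) by (rule eventually_mono) simp
    show "weak_conv_m D (\<psi> 0 0)"
      using conv unfolding weak_conv_m_def weak_conv_def D_def R_def
      by (auto intro: LIMSEQ_ignore_initial_segment)
  qed (rule M)
  \<comment> \<open>For fixed \<open>k\<close> the moments equal the matrix entry as soon as
    \<open>k * q \<le> j\<close>, because \<open>j \<le> R j\<close>.\<close>
  moreover have "eventually (\<lambda>j. (\<integral>x. x ^ k \<partial>D j) = smat_power q T k 0 0) sequentially"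
    using eventually_ge_at_top[of "k * q"]
  proof eventually_elim
    case (elim j)
    then show ?case using D(3)[where j = j and m = k] rep[of k j] R(2)[of j] by simp
  qed
  then have "(\<lambda>j. \<integral>x. x ^ k \<partial>D j) \<longlonglongrightarrow> smat_power q T k 0 0" by (rule tendsto_eventually)
  ultimately show ?thesis by (rule LIMSEQ_unique)
qed

theorem theorem2p21:
  fixes p q :: nat and T :: "nat \<Rightarrow> nat \<Rightarrow> real" and \<nu> \<xi> :: "real mat"
    and \<psi> :: "nat \<Rightarrow> nat \<Rightarrow> real measure"
  assumes "1 \<le> p" and "1 \<le> q"
    and "stochastic T"
    and "positive_band p q T"
    and "positive_bidiagonal_factorization p q T"
    and "lower_unitriangular p \<nu>" and "lower_unitriangular q \<xi>"
    and "eventually_positive_christoffel p q T \<nu> \<xi>"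
    and "spectral_measures p q T \<nu> \<xi> \<psi>"
  shows "(recurrent_chain T \<longleftrightarrow> recurrence_integral (\<psi> 0 0) = \<infinity>) \<and>
         (recurrence_integral (\<psi> 0 0) \<noteq> \<infinity> \<longrightarrow> transient_chain T)"
proof -
  have entry_pos: "0 < T n m" if "n \<le> m + p" "m \<le> n + q" for n m
    using assms(4)[unfolded positive_band_def, rule_format, of n m] that by simp
  have "T i j = 0" if "i + q < j" for i j
    using assms(4)[unfolded positive_band_def, rule_format, of i j] that by (simp split: if_splits)
  then interpret banded_chain q T by unfold_locales (rule assms)
  have "recurrent_chain T \<longleftrightarrow> \<not> summable (\<lambda>k. pw k 0 0)"
  proof (rule recurrent_chain_iff)
    show "0 < T i (Suc i)" for i by (rule entry_pos) (use assms(2) in simp_all)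
    show "0 < T (Suc i) i" for i by (rule entry_pos) (use assms(1) in simp_all)
  qed
  also have "\<dots> \<longleftrightarrow> recurrence_integral (\<psi> 0 0) = \<infinity>"
  proof (rule recurrence_integral_infinite_iff[symmetric])
    show "finite_borel_measure (\<psi> 0 0)" "AE x in \<psi> 0 0. x \<in> {0..1}"
      using assms(1,2,9) unfolding spectral_measures_def by auto
    show "(\<integral>x. x ^ k \<partial>\<psi> 0 0) = pw k 0 0" for k
      by (rule spectral_measure_moments[OF assms])
  qed
  finally show ?thesis by (auto simp: transient_chain_def)
qed

end
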